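(* Let $k$ be a field and let $R$ be a $k$-algebra with (two-sided) ideals $I$ and $J_1\subsetneq J_2$ such that $J_2/J_1$ is free of rank $s$ as a left $R/I$-module and free of rank $t$ as a right $R/I$-module, where $s,t$ are integers. If $s<t$, then there is no filtration $\Gamma$ of $R$ such that $R$, with the filtration $\Gamma$, is both left and right Zariskian.
   Context: All algebras are associative, unital, over a fixed field $k$. Saying that $J_2/J_1$ is a left and a right $R/I$-module (with the structures induced from the $R$-bimodule structure) includes $IJ_2\subseteq J_1$ and $J_2I\subseteq J_1$. A filtration of a $k$-algebra $A$ means an ascending chain of $k$-subspaces $\Gamma=\{\Gamma_i\subseteq\Gamma_{i+1} : i\in\mathbb{Z}\}$ of $A$ such that: (1) $1\in\Gamma_0$ and $\Gamma_i\Gamma_j\subseteq\Gamma_{i+j}$ for all $i,j\in\mathbb{Z}$; (2) $\Gamma$ is finite: $\dim_k\Gamma_i/\Gamma_{i-1}<\infty$ for all $i\in\mathbb{Z}$; (3) $\Gamma$ is exhaustive and separated: $A=\bigcup_{i\in\mathbb{Z}}\Gamma_i$ and $\bigcap_{i\in\mathbb{Z}}\Gamma_i=0$. The Rees ring is $\operatorname{Rees}_\Gamma A=\bigoplus_{i\in\mathbb{Z}}\Gamma_i$ (a graded ring with multiplication $\Gamma_i\times\Gamma_j\to\Gamma_{i+j}$ induced from $A$). The filtered algebra $A$ (or the filtration $\Gamma$) is left Zariskian if (Zar1) $\Gamma_{-1}\subseteq J(\Gamma_0)$, where $J(\Gamma_0)$ is the Jacobson radical of the ring $\Gamma_0$,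 and (Zar2) $\operatorname{Rees}_\Gamma A$ is left noetherian. Right Zariskian is defined in the same way with $\operatorname{Rees}_\Gamma A$ right noetherian. *)

theory Defs
  imports
    "HOL-Algebra.QuotRing"
    "Jordan_Normal_Form.Missing_VectorSpace"
begin

hide_const (open) Multiset.mult

text \<open>The library's \<^locale>\<open>module\<close> is over a commutative ring and its \<^locale>\<open>ideal\<close> is
  two-sided. One-sided notions are given here in their left version; the right versions are
  the left ones over the opposite ring.\<close>

definition opp_ring :: "('a, 'm) ring_scheme \<Rightarrow> ('a, 'm) ring_scheme"
  where "opp_ring R = R\<lparr>mult := \<lambda>x y. y \<otimes>\<^bsub>R\<^esub> x\<rparr>"

locale left_ideal = additive_subgroup I R + ring R for I and R (structure) +
  assumes I_l_closed: "\<lbrakk>a \<in> I; x \<in> carrier R\<rbrakk> \<Longrightarrow> x \<otimes> a \<in> I"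

definition gen_left_ideal :: "('a, 'm) ring_scheme \<Rightarrow> 'a set \<Rightarrow> 'a set"
  where "gen_left_ideal R S = \<Inter>{I. left_ideal I R \<and> S \<subseteq> I}"

locale left_noetherian_ring = ring +
  assumes finitely_gen:
    "left_ideal I R \<Longrightarrow> \<exists>S \<subseteq> carrier R. finite S \<and> I = gen_left_ideal R S"

definition maximal_left_ideal :: "'a set \<Rightarrow> ('a, 'm) ring_scheme \<Rightarrow> bool"
  where "maximal_left_ideal I R \<longleftrightarrow> left_ideal I R \<and> I \<noteq> carrier R \<and>
    (\<forall>L. left_ideal L R \<and> I \<subseteq> L \<longrightarrow> L = I \<or> L = carrier R)"

text \<open>Intersecting with the carrier only matters for the zero ring, which has no maximal
  left ideals.\<close>

definition jacobson_radical :: "('a, 'm) ring_scheme \<Rightarrow> 'a set"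
  where "jacobson_radical R = carrier R \<inter> \<Inter>{I. maximal_left_ideal I R}"

locale left_module = R?: ring R + M?: abelian_group M
  for R :: "('s, 'r) ring_scheme" (structure) and M :: "('s, 'a, 'm) module_scheme" (structure) +
  assumes smult_closed:
      "\<lbrakk>a \<in> carrier R; x \<in> carrier M\<rbrakk> \<Longrightarrow> a \<odot>\<^bsub>M\<^esub> x \<in> carrier M"
    and smult_l_distr:
      "\<lbrakk>a \<in> carrier R; b \<in> carrier R; x \<in> carrier M\<rbrakk> \<Longrightarrow>
        (a \<oplus> b) \<odot>\<^bsub>M\<^esub> x = a \<odot>\<^bsub>M\<^esub> x \<oplus>\<^bsub>M\<^esub> b \<odot>\<^bsub>M\<^esub> x"
    and smult_r_distr:
      "\<lbrakk>a \<in> carrier R; x \<in> carrier M; y \<in> carrier M\<rbrakk> \<Longrightarrow>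
        a \<odot>\<^bsub>M\<^esub> (x \<oplus>\<^bsub>M\<^esub> y) = a \<odot>\<^bsub>M\<^esub> x \<oplus>\<^bsub>M\<^esub> a \<odot>\<^bsub>M\<^esub> y"
    and smult_assoc1:
      "\<lbrakk>a \<in> carrier R; b \<in> carrier R; x \<in> carrier M\<rbrakk> \<Longrightarrow>
        (a \<otimes> b) \<odot>\<^bsub>M\<^esub> x = a \<odot>\<^bsub>M\<^esub> (b \<odot>\<^bsub>M\<^esub> x)"
    and smult_one: "x \<in> carrier M \<Longrightarrow> \<one> \<odot>\<^bsub>M\<^esub> x = x"

text \<open>A basis is a family indexed by \<open>{..<n}\<close>, not a set: this amounts to an isomorphism with
  \<open>R\<^sup>n\<close> also if \<open>R\<close> is the zero ring.\<close>

definition free_of_rank ::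
    "('a, 'm) ring_scheme \<Rightarrow> ('a, 'b, 'n) module_scheme \<Rightarrow> nat \<Rightarrow> bool"
  where "free_of_rank R M n \<longleftrightarrow> left_module R M \<and>
    (\<exists>b \<in> {..<n} \<rightarrow> carrier M. \<forall>x \<in> carrier M.
      \<exists>!c. c \<in> {..<n} \<rightarrow>\<^sub>E carrier R \<and> x = (\<Oplus>\<^bsub>M\<^esub>i\<in>{..<n}. c i \<odot>\<^bsub>M\<^esub> b i))"

text \<open>The quotient group \<open>M/N\<close> for additive subgroups \<open>N \<subseteq> M\<close> of \<open>A\<close>, with \<open>act\<close> as its
  scalar multiplication. The fields \<open>mult\<close> and \<open>one\<close>, present in every module record, play
  no role.\<close>

definition subquotient ::
    "('a, 'm) ring_scheme \<Rightarrow> 'a set \<Rightarrow> 'a set \<Rightarrow> ('s \<Rightarrow> 'a set \<Rightarrow> 'a set) \<Rightarrow> ('s, 'a set) module"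
  where "subquotient A M N act =
    \<lparr>carrier = (\<lambda>x. N +>\<^bsub>A\<^esub> x) ` M, mult = undefined, one = undefined,
     zero = N, add = set_add A, smult = act\<rparr>"

text \<open>The actions of \<open>R Quot I\<close> are \<open>(I + r) (N + x) = N + r x\<close> and
  \<open>(N + x) (I + r) = N + x r\<close>; they are well defined if \<open>I M \<subseteq> N\<close> and \<open>M I \<subseteq> N\<close>
  respectively. Right modules over a ring are left modules over its opposite.\<close>

definition left_subquotient ::
    "('a, 'm) ring_scheme \<Rightarrow> 'a set \<Rightarrow> 'a set \<Rightarrow> ('a set, 'a set) module"
  where "left_subquotient R M N = subquotient R M N (\<lambda>X Y. [mod N:] X \<Otimes>\<^bsub>R\<^esub> Y)"

definition right_subquotient ::
    "('a, 'm) ring_scheme \<Rightarrow> 'a set \<Rightarrow> 'a set \<Rightarrow> ('a set, 'a set) module"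
  where "right_subquotient R M N = subquotient R M N (\<lambda>X Y. [mod N:] Y \<Otimes>\<^bsub>R\<^esub> X)"

definition quotient_space ::
    "('k, 'a, 'm) module_scheme \<Rightarrow> 'a set \<Rightarrow> 'a set \<Rightarrow> ('k, 'a set) module"
  where "quotient_space V M N = subquotient V M N (\<lambda>c Y. \<Union>x\<in>Y. N +>\<^bsub>V\<^esub> (c \<odot>\<^bsub>V\<^esub> x))"

text \<open>Unlike the library's \<^locale>\<open>algebra\<close>, the multiplication need not be commutative.\<close>

locale assoc_algebra = vectorspace K A + A?: ring A
  for K :: "('k, 'l) ring_scheme" (structure) and A :: "('k, 'a, 'm) module_scheme" (structure) +
  assumes smult_mult_left:
      "\<lbrakk>c \<in> carrier K; x \<in> carrier A; y \<in> carrier A\<rbrakk> \<Longrightarrow>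
        (c \<odot>\<^bsub>A\<^esub> x) \<otimes>\<^bsub>A\<^esub> y = c \<odot>\<^bsub>A\<^esub> (x \<otimes>\<^bsub>A\<^esub> y)"
    and smult_mult_right:
      "\<lbrakk>c \<in> carrier K; x \<in> carrier A; y \<in> carrier A\<rbrakk> \<Longrightarrow>
        x \<otimes>\<^bsub>A\<^esub> (c \<odot>\<^bsub>A\<^esub> y) = c \<odot>\<^bsub>A\<^esub> (x \<otimes>\<^bsub>A\<^esub> y)"

locale algebra_filtration = assoc_algebra K A
  for K :: "('k, 'l) ring_scheme" (structure) and A :: "('k, 'a, 'm) module_scheme" (structure) +
  fixes \<Gamma> :: "int \<Rightarrow> 'a set"
  assumes subspace: "subspace K (\<Gamma> i) A"
    and ascending: "\<Gamma> i \<subseteq> \<Gamma> (i + 1)"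
    and one_mem: "\<one>\<^bsub>A\<^esub> \<in> \<Gamma> 0"
    and mult_mem: "\<lbrakk>x \<in> \<Gamma> i; y \<in> \<Gamma> j\<rbrakk> \<Longrightarrow> x \<otimes>\<^bsub>A\<^esub> y \<in> \<Gamma> (i + j)"
    and finite_steps: "vectorspace.fin_dim K (quotient_space A (\<Gamma> i) (\<Gamma> (i - 1)))"
    and exhaustive: "carrier A = (\<Union>i. \<Gamma> i)"
    and separated: "(\<Inter>i. \<Gamma> i) = {\<zero>\<^bsub>A\<^esub>}"

text \<open>An element of the Rees ring is the finitely supported family of its homogeneous
  components; the product is the convolution.\<close>

definition rees_ring :: "('a, 'm) ring_scheme \<Rightarrow> (int \<Rightarrow> 'a set) \<Rightarrow> (int \<Rightarrow> 'a) ring"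
  where "rees_ring A \<Gamma> =
    \<lparr>carrier = {f. (\<forall>i. f i \<in> \<Gamma> i) \<and> finite {i. f i \<noteq> \<zero>\<^bsub>A\<^esub>}},
     mult = (\<lambda>f g n. \<Oplus>\<^bsub>A\<^esub>i\<in>{i. f i \<noteq> \<zero>\<^bsub>A\<^esub>}. f i \<otimes>\<^bsub>A\<^esub> g (n - i)),
     one = (\<lambda>n. if n = 0 then \<one>\<^bsub>A\<^esub> else \<zero>\<^bsub>A\<^esub>),
     zero = (\<lambda>n. \<zero>\<^bsub>A\<^esub>),
     add = (\<lambda>f g n. f n \<oplus>\<^bsub>A\<^esub> g n)\<rparr>"

definition left_zariskian :: "('a, 'm) ring_scheme \<Rightarrow> (int \<Rightarrow> 'a set) \<Rightarrow> bool"
  where "left_zariskian A \<Gamma> \<longleftrightarrow>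
    \<Gamma> (- 1) \<subseteq> jacobson_radical (A\<lparr>carrier := \<Gamma> 0\<rparr>) \<and> left_noetherian_ring (rees_ring A \<Gamma>)"

definition right_zariskian :: "('a, 'm) ring_scheme \<Rightarrow> (int \<Rightarrow> 'a set) \<Rightarrow> bool"
  where "right_zariskian A \<Gamma> \<longleftrightarrow>
    \<Gamma> (- 1) \<subseteq> jacobson_radical (A\<lparr>carrier := \<Gamma> 0\<rparr>) \<and>
    left_noetherian_ring (opp_ring (rees_ring A \<Gamma>))"

end

theory Submission
  imports Complex_Main Defs
begin

text \<open>Write \<open>F\<^sub>n\<close> for the image of \<open>\<Gamma>\<^sub>n\<close> in \<open>R/I\<close>, write \<open>M\<^sub>n\<close> for the image of
  \<open>\<Gamma>\<^sub>n \<inter> J\<^sub>2\<close> in \<open>J\<^sub>2/J\<^sub>1\<close>, and let \<open>D(m,n) = dim F\<^sub>n/F\<^sub>m\<close>. The proof plays three facts against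
  each other.

  First, the filtration \<open>M\<close> is compatible with both bases of \<open>J\<^sub>2/J\<^sub>1\<close>. The Rees ring is left
  noetherian, so \<open>M\<close> differs from the filtration by the left combinations of the left basis with
  coefficients in \<open>F\<^sub>n\<close> only by a bounded shift, and likewise on the right
  (\<open>sandwich\<close>). Counting dimensions in the two descriptions of the same quotient gives a constant
  \<open>c\<close> with \<open>t D(m,n) \<le> s D(m-c, n+c)\<close> (\<open>rank_inequality\<close>). If \<open>s < t\<close>, then either
  \<open>D\<close> vanishes identically or \<open>D(m-ck, n+ck)\<close> grows exponentially in \<open>k\<close> for some \<open>m \<le> n\<close>.

  Secondly, a noetherian Rees ring excludes exponential growth: for every \<open>r > 1\<close> the numbers
  \<open>dim \<Gamma>\<^sub>i/\<Gamma>\<^sub>i\<^sub>-\<^sub>1\<close> are bounded by a multiple of \<open>r\<^bsup>\<bar>i\<bar>\<^esup>\<close> (\<open>subexponential_jumps\<close>). This is a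
  theorem of Stephenson and Zhang for graded rings. Exponential growth leaves room for
  elements \<open>x\<^sub>0, x\<^sub>1, \<dots>\<close> of rapidly increasing (or decreasing) degrees none of which lies in the
  graded left ideal generated by its predecessors, because the dimensions that the predecessors
  can contribute in the degree of \<open>x\<^sub>k\<close> form a series with small sum.

  Finally, \<open>D\<close> does not vanish. Otherwise \<open>1 = u + a\<close> with \<open>u \<in> \<Gamma>\<^sub>-\<^sub>1 \<subseteq> J(\<Gamma>\<^sub>0)\<close> and
  \<open>a \<in> I\<close>; no maximal left ideal of \<open>\<Gamma>\<^sub>0\<close> contains both \<open>u\<close> and \<open>a\<close>, so
  \<open>I \<inter> \<Gamma>\<^sub>0 = \<Gamma>\<^sub>0\<close> and \<open>I = R\<close> (\<open>one_in_ideal_by_jacobson\<close>), whence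
  \<open>J\<^sub>2 = R J\<^sub>2 \<subseteq> J\<^sub>1\<close>.

  Dimensions of quotients \<open>W/U\<close> are measured inside the ambient space by the least number of
  vectors that have to be adjoined to \<open>U\<close> one after the other in order to reach \<open>W\<close>, which turns
  dimension counts into inductions on that number. The left and the right side are treated by the same lemmas,
  in which multiplication by ring elements is an operation \<open>act\<close> and multiplication by the
  elements of the basis is a family of linear maps \<open>\<phi>\<close>.\<close>

section \<open>Relative dimension of subspaces\<close>

context vectorspace
begin

definition adjoin :: "'c set \<Rightarrow> 'c \<Rightarrow> 'c set"
  where "adjoin U x = {u \<oplus>\<^bsub>V\<^esub> c \<odot>\<^bsub>V\<^esub> x | u c. u \<in> U \<and> c \<in> carrier K}"

text \<open>The quotient \<open>W/U\<close> is spanned by \<open>n\<close> vectors. Adjoining the vectors one at a time makes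
  every later statement about dimensions an induction on \<open>n\<close> without linear combinations.\<close>

primrec generated_over :: "nat \<Rightarrow> 'c set \<Rightarrow> 'c set \<Rightarrow> bool"
  where
    "generated_over 0 U W \<longleftrightarrow> U = W"
  | "generated_over (Suc n) U W \<longleftrightarrow> (\<exists>x\<in>W. generated_over n (adjoin U x) W)"

lemma submoduleD:
  assumes "submodule K U V"
  shows "U \<subseteq> carrier V" and "\<zero>\<^bsub>V\<^esub> \<in> U"
    and "\<lbrakk>x \<in> U; y \<in> U\<rbrakk> \<Longrightarrow> x \<oplus>\<^bsub>V\<^esub> y \<in> U"
    and "\<lbrakk>c \<in> carrier K; x \<in> U\<rbrakk> \<Longrightarrow> c \<odot>\<^bsub>V\<^esub> x \<in> U"
    and "x \<in> U \<Longrightarrow> \<ominus>\<^bsub>V\<^esub> x \<in> U"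
    and "\<lbrakk>x \<in> U; y \<in> U\<rbrakk> \<Longrightarrow> x \<ominus>\<^bsub>V\<^esub> y \<in> U"
proof -
  interpret submodule K U V by (rule assms)
  show "U \<subseteq> carrier V" "\<zero>\<^bsub>V\<^esub> \<in> U" by (simp_all add: subset)
  show add: "x \<oplus>\<^bsub>V\<^esub> y \<in> U" if "x \<in> U" "y \<in> U" for x y using that by simp
  show smult: "c \<odot>\<^bsub>V\<^esub> x \<in> U" if "c \<in> carrier K" "x \<in> U" for c x
    using that by simp
  have neg: "\<ominus>\<^bsub>V\<^esub> x \<in> U" if "x \<in> U" for x
  proof -
    have "(\<ominus>\<^bsub>K\<^esub> \<one>\<^bsub>K\<^esub>) \<odot>\<^bsub>V\<^esub> x \<in> U" by (rule smult) (use that in simp_all)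
    then show ?thesis by (metis smult_minus_1 subset subsetD that)
  qed
  show "x \<in> U \<Longrightarrow> \<ominus>\<^bsub>V\<^esub> x \<in> U" by (rule neg)
  show "x \<ominus>\<^bsub>V\<^esub> y \<in> U" if "x \<in> U" "y \<in> U"
    using that add neg unfolding a_minus_def by blast
qed

lemma submoduleI:
  assumes "U \<subseteq> carrier V" and "\<zero>\<^bsub>V\<^esub> \<in> U"
    and "\<And>x y. \<lbrakk>x \<in> U; y \<in> U\<rbrakk> \<Longrightarrow> x \<oplus>\<^bsub>V\<^esub> y \<in> U"
    and "\<And>c x. \<lbrakk>c \<in> carrier K; x \<in> U\<rbrakk> \<Longrightarrow> c \<odot>\<^bsub>V\<^esub> x \<in> U"
  shows "submodule K U V"
  using assms module_axioms by (auto intro!: submodule.intro)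

lemma submodule_carrier: "submodule K (carrier V) V"
  by (rule submoduleI) auto

lemma submodule_inter:
  assumes "submodule K U V" "submodule K W V"
  shows "submodule K (U \<inter> W) V"
  by (rule submoduleI) (use submoduleD[OF assms(1)] submoduleD[OF assms(2)] in auto)

lemma set_add_memI: "\<lbrakk>u \<in> U; w \<in> W\<rbrakk> \<Longrightarrow> u \<oplus>\<^bsub>V\<^esub> w \<in> U <+>\<^bsub>V\<^esub> W"
  by (auto simp: set_add_def')

lemma set_add_memE:
  assumes "x \<in> U <+>\<^bsub>V\<^esub> W"
  obtains u w where "u \<in> U" "w \<in> W" "x = u \<oplus>\<^bsub>V\<^esub> w"
  using assms by (auto simp: set_add_def')

lemma submodule_set_add:
  assumes U: "submodule K U V" and W: "submodule K W V"
  shows "submodule K (U <+>\<^bsub>V\<^esub> W) V"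
proof (rule submoduleI)
  note [simp] = subsetD[OF submoduleD(1)[OF U]] subsetD[OF submoduleD(1)[OF W]]
  show "U <+>\<^bsub>V\<^esub> W \<subseteq> carrier V" by (auto elim!: set_add_memE)
  show "\<zero>\<^bsub>V\<^esub> \<in> U <+>\<^bsub>V\<^esub> W"
    using set_add_memI[OF submoduleD(2)[OF U] submoduleD(2)[OF W]] by simp
  show "x \<oplus>\<^bsub>V\<^esub> y \<in> U <+>\<^bsub>V\<^esub> W" if x: "x \<in> U <+>\<^bsub>V\<^esub> W" and y: "y \<in> U <+>\<^bsub>V\<^esub> W" for x y
  proof -
    obtain u w u' w' where *: "u \<in> U" "w \<in> W" "u' \<in> U" "w' \<in> W"
      "x = u \<oplus>\<^bsub>V\<^esub> w" "y = u' \<oplus>\<^bsub>V\<^esub> w'"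
      using x y by (elim set_add_memE)
    then have "x \<oplus>\<^bsub>V\<^esub> y = (u \<oplus>\<^bsub>V\<^esub> u') \<oplus>\<^bsub>V\<^esub> (w \<oplus>\<^bsub>V\<^esub> w')"
      by (simp add: module.M.a_ac)
    then show ?thesis using * by (simp add: set_add_memI submoduleD(3)[OF U] submoduleD(3)[OF W])
  qed
  show "c \<odot>\<^bsub>V\<^esub> x \<in> U <+>\<^bsub>V\<^esub> W" if c: "c \<in> carrier K" and x: "x \<in> U <+>\<^bsub>V\<^esub> W" for c x
  proof -
    obtain u w where *: "u \<in> U" "w \<in> W" "x = u \<oplus>\<^bsub>V\<^esub> w" using x by (elim set_add_memE)
    then have "c \<odot>\<^bsub>V\<^esub> x = c \<odot>\<^bsub>V\<^esub> u \<oplus>\<^bsub>V\<^esub> c \<odot>\<^bsub>V\<^esub> w"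
      using c by (simp add: smult_r_distr)
    then show ?thesis
      using * c by (simp add: set_add_memI submoduleD(4)[OF U] submoduleD(4)[OF W])
  qed
qed

lemma set_add_upper:
  assumes U: "submodule K U V" and W: "submodule K W V"
  shows "U \<subseteq> U <+>\<^bsub>V\<^esub> W" and "W \<subseteq> U <+>\<^bsub>V\<^esub> W"
  using set_add_memI[OF _ submoduleD(2)[OF W], of _ U] set_add_memI[OF submoduleD(2)[OF U], of _ W]
    subsetD[OF submoduleD(1)[OF U]] subsetD[OF submoduleD(1)[OF W]]
  by force+

lemma set_add_least:
  assumes "submodule K Z V" "U \<subseteq> Z" "W \<subseteq> Z"
  shows "U <+>\<^bsub>V\<^esub> W \<subseteq> Z"
  using assms submoduleD(3)[OF assms(1)] by (auto elim!: set_add_memE)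

lemma set_add_mono: "\<lbrakk>U \<subseteq> U'; W \<subseteq> W'\<rbrakk> \<Longrightarrow> U <+>\<^bsub>V\<^esub> W \<subseteq> U' <+>\<^bsub>V\<^esub> W'"
  by (fastforce simp: set_add_def')

lemma submodule_image:
  assumes U: "submodule K U V" and \<phi>: "\<phi> \<in> module_hom K V V"
  shows "submodule K (\<phi> ` U) V"
proof (rule submoduleI)
  interpret mod_hom K V V \<phi> by unfold_locales (rule \<phi>)
  note [simp] = subsetD[OF submoduleD(1)[OF U]]
  show "\<phi> ` U \<subseteq> carrier V" by (auto intro!: f_im)
  show "\<zero>\<^bsub>V\<^esub> \<in> \<phi> ` U" using f0_is_0 submoduleD(2)[OF U] by (metis imageI)
  show "\<And>x y. x \<in> \<phi> ` U \<Longrightarrow> y \<in> \<phi> ` U \<Longrightarrow> x \<oplus>\<^bsub>V\<^esub> y \<in> \<phi> ` U"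
    using submoduleD(3)[OF U] by (auto simp: f_add[symmetric] simp del: f_add)
  show "\<And>c x. c \<in> carrier K \<Longrightarrow> x \<in> \<phi> ` U \<Longrightarrow> c \<odot>\<^bsub>V\<^esub> x \<in> \<phi> ` U"
    using submoduleD(4)[OF U] by (auto simp: f_smult[symmetric] simp del: f_smult)
qed

lemma adjoinI: "\<lbrakk>u \<in> U; c \<in> carrier K\<rbrakk> \<Longrightarrow> u \<oplus>\<^bsub>V\<^esub> c \<odot>\<^bsub>V\<^esub> x \<in> adjoin U x"
  by (auto simp: adjoin_def)

lemma adjoinE:
  assumes "y \<in> adjoin U x"
  obtains u c where "u \<in> U" "c \<in> carrier K" "y = u \<oplus>\<^bsub>V\<^esub> c \<odot>\<^bsub>V\<^esub> x"
  using assms by (auto simp: adjoin_def)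

lemma submodule_adjoin:
  assumes U: "submodule K U V" and x[simp]: "x \<in> carrier V"
  shows "submodule K (adjoin U x) V"
proof -
  note [simp] = subsetD[OF submoduleD(1)[OF U]]
  show ?thesis
  proof (rule submoduleI)
    show "adjoin U x \<subseteq> carrier V" by (auto elim!: adjoinE)
    show "\<zero>\<^bsub>V\<^esub> \<in> adjoin U x"
      using adjoinI[OF submoduleD(2)[OF U] module.R.zero_closed, of x] by simp
    show "y \<oplus>\<^bsub>V\<^esub> z \<in> adjoin U x" if y: "y \<in> adjoin U x" and z: "z \<in> adjoin U x" for y z
    proof -
      obtain u c u' c' where *: "u \<in> U" "c \<in> carrier K" "u' \<in> U" "c' \<in> carrier K"
        "y = u \<oplus>\<^bsub>V\<^esub> c \<odot>\<^bsub>V\<^esub> x" "z = u' \<oplus>\<^bsub>V\<^esub> c' \<odot>\<^bsub>V\<^esub> x"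
        using y z by (elim adjoinE)
      then have "y \<oplus>\<^bsub>V\<^esub> z = (u \<oplus>\<^bsub>V\<^esub> u') \<oplus>\<^bsub>V\<^esub> (c \<oplus>\<^bsub>K\<^esub> c') \<odot>\<^bsub>V\<^esub> x"
        by (simp add: module.M.a_ac smult_l_distr)
      then show ?thesis using * by (simp add: adjoinI submoduleD(3)[OF U])
    qed
    show "d \<odot>\<^bsub>V\<^esub> y \<in> adjoin U x" if d: "d \<in> carrier K" and y: "y \<in> adjoin U x" for d y
    proof -
      obtain u c where *: "u \<in> U" "c \<in> carrier K" "y = u \<oplus>\<^bsub>V\<^esub> c \<odot>\<^bsub>V\<^esub> x"
        using y by (elim adjoinE)
      then have "d \<odot>\<^bsub>V\<^esub> y = d \<odot>\<^bsub>V\<^esub> u \<oplus>\<^bsub>V\<^esub> (d \<otimes>\<^bsub>K\<^esub> c) \<odot>\<^bsub>V\<^esub> x"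
        using d by (simp add: smult_r_distr smult_assoc1)
      then show ?thesis using * d by (simp add: adjoinI submoduleD(4)[OF U])
    qed
  qed
qed

lemma adjoin_upper:
  assumes U: "submodule K U V" and x: "x \<in> carrier V"
  shows "U \<subseteq> adjoin U x" and "x \<in> adjoin U x"
proof -
  show "U \<subseteq> adjoin U x"
  proof
    fix u assume u: "u \<in> U"
    have "u \<oplus>\<^bsub>V\<^esub> \<zero>\<^bsub>K\<^esub> \<odot>\<^bsub>V\<^esub> x = u"
      using x subsetD[OF submoduleD(1)[OF U] u] by simp
    then show "u \<in> adjoin U x" using adjoinI[OF u module.R.zero_closed, of x] by simp
  qed
  show "x \<in> adjoin U x"
    using adjoinI[OF submoduleD(2)[OF U] module.R.one_closed, of x] x by simp
qed

lemma adjoin_least: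
  assumes "submodule K W V" "U \<subseteq> W" "x \<in> W"
  shows "adjoin U x \<subseteq> W"
  using assms submoduleD(3,4)[OF assms(1)] by (auto elim!: adjoinE)

lemma generated_over_trans:
  assumes "submodule K U V" "submodule K W V" "submodule K Z V" "W \<subseteq> Z"
    "generated_over n U W" "generated_over m W Z"
  shows "generated_over (n + m) U Z"
  using assms
proof (induction n arbitrary: U)
  case (Suc n)
  then obtain x where x: "x \<in> W" "generated_over n (adjoin U x) W" by auto
  then have "x \<in> carrier V" using Suc.prems submoduleD(1) by blast
  then have "generated_over (n + m) (adjoin U x) Z"
    using Suc.IH[of "adjoin U x"] x Suc.prems submodule_adjoin by blast
  then show ?case using x(1) Suc.prems by auto
qed simp

text \<open>A linear map that sends \<open>U\<close> into \<open>U'\<close> induces a surjection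
  from \<open>W/U\<close> onto \<open>(U' + \<phi> W)/U'\<close>.\<close>

lemma generated_over_image:
  assumes "submodule K U V" "submodule K W V" "submodule K U' V" "\<phi> \<in> module_hom K V V"
    "generated_over n U W" "\<phi> ` U \<subseteq> U'"
  shows "generated_over n U' (U' <+>\<^bsub>V\<^esub> \<phi> ` W)"
  using assms
proof (induction n arbitrary: U U')
  case 0
  have "U' <+>\<^bsub>V\<^esub> \<phi> ` W = U'"
    using 0 set_add_least[of U' U' "\<phi> ` W"] set_add_upper(1)[of U' "\<phi> ` W"] submodule_image by auto
  then show ?case by simp
next
  case (Suc n)
  then obtain x where x: "x \<in> W" "generated_over n (adjoin U x) W" by auto
  interpret mod_hom K V V \<phi> by unfold_locales (rule Suc.prems(4))
  have xc: "x \<in> carrier V" using x Suc.prems submoduleD(1) by blast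
  have \<phi>x: "\<phi> x \<in> carrier V" using xc by (rule f_im)
  have W': "submodule K (\<phi> ` W) V" using submodule_image Suc.prems by blast
  have *: "\<phi> ` adjoin U x \<subseteq> adjoin U' (\<phi> x)"
    using Suc.prems(6) subsetD[OF submoduleD(1)[OF Suc.prems(1)]] xc
    by (auto elim!: adjoinE intro!: adjoinI)
  have "generated_over n (adjoin U' (\<phi> x)) (adjoin U' (\<phi> x) <+>\<^bsub>V\<^esub> \<phi> ` W)"
    using Suc.IH[of "adjoin U x" "adjoin U' (\<phi> x)"] x * Suc.prems submodule_adjoin xc \<phi>x by blast
  moreover have "adjoin U' (\<phi> x) <+>\<^bsub>V\<^esub> \<phi> ` W = U' <+>\<^bsub>V\<^esub> \<phi> ` W"
  proof
    have S: "submodule K (U' <+>\<^bsub>V\<^esub> \<phi> ` W) V" using submodule_set_add W' Suc.prems by blast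
    note up = set_add_upper[OF Suc.prems(3) W']
    show "adjoin U' (\<phi> x) <+>\<^bsub>V\<^esub> \<phi> ` W \<subseteq> U' <+>\<^bsub>V\<^esub> \<phi> ` W"
      using up x by (intro set_add_least[OF S] adjoin_least[OF S]) auto
    show "U' <+>\<^bsub>V\<^esub> \<phi> ` W \<subseteq> adjoin U' (\<phi> x) <+>\<^bsub>V\<^esub> \<phi> ` W"
      using adjoin_upper(1)[OF Suc.prems(3) \<phi>x] by (intro set_add_mono) auto
  qed
  moreover have "\<phi> x \<in> U' <+>\<^bsub>V\<^esub> \<phi> ` W"
    using set_add_upper(2)[OF Suc.prems(3) W'] x by blast
  ultimately show ?case by auto
qed

lemma id_module_hom: "(\<lambda>x. x) \<in> module_hom K V V"
  by (auto simp: module_hom_def)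

text \<open>The hypotheses say that \<open>\<phi>\<close> induces an isomorphism from \<open>W'/U'\<close> onto \<open>W/U\<close>, so
  generators can be pulled back. For \<open>\<phi> = id\<close> this is the second isomorphism theorem.\<close>

lemma generated_over_preimage:
  assumes "submodule K U V" "submodule K W V" "submodule K U' V" "submodule K W' V"
    and "\<phi> \<in> module_hom K V V" "generated_over n U W"
    and "\<And>y. y \<in> W' \<Longrightarrow> \<phi> y \<in> U \<longleftrightarrow> y \<in> U'" and "U' \<subseteq> W'" "\<phi> ` W' \<subseteq> W" "W \<subseteq> U <+>\<^bsub>V\<^esub> \<phi> ` W'"
  shows "generated_over n U' W'"
  using assms
proof (induction n arbitrary: U U')
  case 0
  then show ?case by auto
next
  case (Suc n)
  then obtain x where x: "x \<in> W" "generated_over n (adjoin U x) W" by auto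
  interpret mod_hom K V V \<phi> by unfold_locales (rule Suc.prems(5))
  note U = Suc.prems(1) and W = Suc.prems(2) and U' = Suc.prems(3) and W' = Suc.prems(4)
  note carr[simp] = subsetD[OF submoduleD(1)[OF U]] subsetD[OF submoduleD(1)[OF W]]
    subsetD[OF submoduleD(1)[OF U']] subsetD[OF submoduleD(1)[OF W']]
  obtain u y where y: "u \<in> U" "y \<in> W'" "x = u \<oplus>\<^bsub>V\<^esub> \<phi> y"
    using x(1) Suc.prems(10) unfolding set_add_def' by blast
  have "\<phi> z \<in> adjoin U x \<longleftrightarrow> z \<in> adjoin U' y" if z: "z \<in> W'" for z
  proof
    assume "\<phi> z \<in> adjoin U x"
    then obtain v c where v: "v \<in> U" "c \<in> carrier K" "\<phi> z = v \<oplus>\<^bsub>V\<^esub> c \<odot>\<^bsub>V\<^esub> x" by (rule adjoinE)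
    have zc: "z \<in> carrier V" "y \<in> carrier V" "u \<in> carrier V" "v \<in> carrier V" using z y v by auto
    have "\<phi> (z \<ominus>\<^bsub>V\<^esub> c \<odot>\<^bsub>V\<^esub> y) = v \<oplus>\<^bsub>V\<^esub> c \<odot>\<^bsub>V\<^esub> u"
    proof -
      have "\<phi> (z \<ominus>\<^bsub>V\<^esub> c \<odot>\<^bsub>V\<^esub> y) = \<phi> z \<ominus>\<^bsub>V\<^esub> c \<odot>\<^bsub>V\<^esub> \<phi> y" using v(2) zc by (subst f_minus) auto
      also have "\<dots> = (v \<oplus>\<^bsub>V\<^esub> (c \<odot>\<^bsub>V\<^esub> u \<oplus>\<^bsub>V\<^esub> c \<odot>\<^bsub>V\<^esub> \<phi> y)) \<ominus>\<^bsub>V\<^esub> c \<odot>\<^bsub>V\<^esub> \<phi> y"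
        using v y zc by (simp add: smult_r_distr f_im)
      also have "\<dots> = v \<oplus>\<^bsub>V\<^esub> c \<odot>\<^bsub>V\<^esub> u"
        using v(2) zc f_im[OF zc(2)] 
        by (simp add: a_minus_def module.M.a_assoc module.M.r_neg)
      finally show ?thesis .
    qed
    then have "\<phi> (z \<ominus>\<^bsub>V\<^esub> c \<odot>\<^bsub>V\<^esub> y) \<in> U" using v y submoduleD(3,4)[OF U] by auto
    then have "z \<ominus>\<^bsub>V\<^esub> c \<odot>\<^bsub>V\<^esub> y \<in> U'" using Suc.prems(7) z y v submoduleD(4,6)[OF W'] by blast
    moreover have "z = (z \<ominus>\<^bsub>V\<^esub> c \<odot>\<^bsub>V\<^esub> y) \<oplus>\<^bsub>V\<^esub> c \<odot>\<^bsub>V\<^esub> y"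
      using zc v by (simp add: a_minus_def module.M.a_assoc module.M.l_neg)
    ultimately show "z \<in> adjoin U' y" using adjoinI v(2) by metis
  next
    assume "z \<in> adjoin U' y"
    then obtain v c where v: "v \<in> U'" "c \<in> carrier K" "z = v \<oplus>\<^bsub>V\<^esub> c \<odot>\<^bsub>V\<^esub> y" by (rule adjoinE)
    have vW: "v \<in> W'" using v Suc.prems(8) by auto
    have zc: "y \<in> carrier V" "u \<in> carrier V" "v \<in> carrier V" using z y v by auto
    have uv: "\<phi> v \<in> U" using Suc.prems(7) vW v by blast
    have "\<phi> z = \<phi> v \<oplus>\<^bsub>V\<^esub> c \<odot>\<^bsub>V\<^esub> \<phi> y" using v zc by simp
    also have "\<dots> = (\<phi> v \<ominus>\<^bsub>V\<^esub> c \<odot>\<^bsub>V\<^esub> u) \<oplus>\<^bsub>V\<^esub> (c \<odot>\<^bsub>V\<^esub> u \<oplus>\<^bsub>V\<^esub> c \<odot>\<^bsub>V\<^esub> \<phi> y)"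
    proof -
      have cc: "\<phi> v \<in> carrier V" "c \<odot>\<^bsub>V\<^esub> u \<in> carrier V" "c \<odot>\<^bsub>V\<^esub> \<phi> y \<in> carrier V"
        using f_im[OF zc(1)] f_im[OF zc(3)] zc(2) v(2) by (simp_all only: smult_closed)
      then show ?thesis
        by (simp add: a_minus_def module.M.a_assoc module.M.r_neg1)
    qed
    also have "\<dots> = (\<phi> v \<ominus>\<^bsub>V\<^esub> c \<odot>\<^bsub>V\<^esub> u) \<oplus>\<^bsub>V\<^esub> c \<odot>\<^bsub>V\<^esub> x"
      using v(2) zc y(3) f_im[OF zc(1)] by (simp add: smult_r_distr)
    finally have "\<phi> z = (\<phi> v \<ominus>\<^bsub>V\<^esub> c \<odot>\<^bsub>V\<^esub> u) \<oplus>\<^bsub>V\<^esub> c \<odot>\<^bsub>V\<^esub> x" .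
    moreover have "\<phi> v \<ominus>\<^bsub>V\<^esub> c \<odot>\<^bsub>V\<^esub> u \<in> U"
      by (rule submoduleD(6)[OF U uv submoduleD(4)[OF U v(2) y(1)]])
    ultimately show "\<phi> z \<in> adjoin U x" using adjoinI[OF _ v(2)] by simp
  qed
  moreover have "W \<subseteq> adjoin U x <+>\<^bsub>V\<^esub> \<phi> ` W'"
    using Suc.prems(10) set_add_mono[OF adjoin_upper(1)[OF U carr(2)[OF x(1)]] order_refl] by blast
  moreover have "adjoin U' y \<subseteq> W'"
    by (rule adjoin_least[OF W' Suc.prems(8) y(2)])
  ultimately have "generated_over n (adjoin U' y) W'"
    using Suc.IH[OF submodule_adjoin[OF U carr(2)[OF x(1)]] W submodule_adjoin[OF U' carr(4)[OF y(2)]]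
        W' Suc.prems(5) x(2) _ _ Suc.prems(9)] by blast
  then show ?case using y(2) by auto
qed

text \<open>Additivity of the dimension, in the direction that depends on scalars being invertible. The
  first adjoined vector \<open>x\<close> counts for \<open>W/U\<close> if it lies in \<open>W\<close>. If it does not, it counts for
  \<open>Z/W\<close>, and it is useless for \<open>W/U\<close>, since \<open>K x\<close> then meets \<open>W\<close> only in \<open>0\<close>.\<close>

lemma generated_over_split:
  assumes "submodule K U V" "submodule K W V" "submodule K Z V" "U \<subseteq> W" "W \<subseteq> Z"
    and "generated_over n U Z"
  shows "\<exists>a b. a + b \<le> n \<and> generated_over a U W \<and> generated_over b W Z"
  using assms
proof (induction n arbitrary: U W)
  case 0
  then show ?case by auto
next
  case (Suc n)
  then obtain x where x: "x \<in> Z" "generated_over n (adjoin U x) Z" by auto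
  note U = Suc.prems(1) and W = Suc.prems(2) and Z = Suc.prems(3)
  note carr[simp] = subsetD[OF submoduleD(1)[OF U]] subsetD[OF submoduleD(1)[OF W]]
    subsetD[OF submoduleD(1)[OF Z]]
  have xc: "x \<in> carrier V" using x by auto
  show ?case
  proof (cases "x \<in> W")
    case True
    then obtain a b where "a + b \<le> n" "generated_over a (adjoin U x) W" "generated_over b W Z"
      using Suc.IH[of "adjoin U x" W] x Suc.prems submodule_adjoin[OF U xc] adjoin_least[OF W]
      by blast
    then show ?thesis using True by (intro exI[of _ "Suc a"] exI[of _ b]) auto
  next
    case False
    have sub: "adjoin U x \<subseteq> adjoin W x" using Suc.prems by (auto simp: adjoin_def)
    have W': "submodule K (adjoin W x) V" using submodule_adjoin[OF W xc] .
    obtain a b where ab: "a + b \<le> n" "generated_over a (adjoin U x) (adjoin W x)"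
        "generated_over b (adjoin W x) Z"
      using Suc.IH[of "adjoin U x" "adjoin W x"] x Suc.prems submodule_adjoin xc adjoin_least[OF Z] sub
      by blast
    have "generated_over a U W"
    proof (rule generated_over_preimage[OF submodule_adjoin[OF U xc] W' U W id_module_hom ab(2)])
      show "y \<in> adjoin U x \<longleftrightarrow> y \<in> U" if y: "y \<in> W" for y
      proof
        assume "y \<in> adjoin U x"
        then obtain u c where u: "u \<in> U" "c \<in> carrier K" "y = u \<oplus>\<^bsub>V\<^esub> c \<odot>\<^bsub>V\<^esub> x" by (rule adjoinE)
        have "c = \<zero>\<^bsub>K\<^esub>"
        proof (rule ccontr)
          assume c: "c \<noteq> \<zero>\<^bsub>K\<^esub>"
          have uc: "u \<in> carrier V" using u by auto
          have "\<ominus>\<^bsub>V\<^esub> u \<oplus>\<^bsub>V\<^esub> y \<in> W"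
            using u y submoduleD(5)[OF W] submoduleD(3)[OF W] Suc.prems by blast
          moreover have "\<ominus>\<^bsub>V\<^esub> u \<oplus>\<^bsub>V\<^esub> y = c \<odot>\<^bsub>V\<^esub> x"
            using u uc xc by (simp add: module.M.a_assoc[symmetric] module.M.l_neg)
          ultimately have "inv\<^bsub>K\<^esub> c \<odot>\<^bsub>V\<^esub> (c \<odot>\<^bsub>V\<^esub> x) \<in> W"
            using submoduleD(4)[OF W] c u field.field_Units by auto
          then have "(inv\<^bsub>K\<^esub> c \<otimes>\<^bsub>K\<^esub> c) \<odot>\<^bsub>V\<^esub> x \<in> W"
            using c u xc field.field_Units by (subst smult_assoc1) auto
          then show False using False c u xc field.field_Units by simp
        qed
        then show "y \<in> U" using u xc by simp
      qed (use adjoin_upper(1)[OF U xc] in auto)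
      show "U \<subseteq> W" by fact
      show "(\<lambda>x. x) ` W \<subseteq> adjoin W x" using adjoin_upper(1)[OF W xc] by simp
      show "adjoin W x \<subseteq> adjoin U x <+>\<^bsub>V\<^esub> (\<lambda>x. x) ` W"
        using set_add_upper[OF submodule_adjoin[OF U xc] W] adjoin_upper(2)[OF U xc]
        by (intro adjoin_least submodule_set_add submodule_adjoin U W xc) (auto simp: W)
    qed
    moreover have "generated_over (Suc b) W Z" using ab x by auto
    ultimately show ?thesis using ab(1) by (intro exI[of _ a] exI[of _ "Suc b"]) auto
  qed
qed

text \<open>The dimension of \<open>W/U\<close>, provided that it is finite.\<close>

definition rank_over :: "'c set \<Rightarrow> 'c set \<Rightarrow> nat"
  where "rank_over U W = (LEAST n. generated_over n U W)"

lemma rank_over_le: "generated_over n U W \<Longrightarrow> rank_over U W \<le> n"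
  unfolding rank_over_def by (rule Least_le)

lemma generated_over_rank: "generated_over n U W \<Longrightarrow> generated_over (rank_over U W) U W"
  unfolding rank_over_def by (rule LeastI)

text \<open>The sum of \<open>J\<close> and of the images of \<open>X\<close> under the first \<open>k\<close> maps. For maps
  \<open>\<phi>\<^sub>i\<close> that multiply by elements \<open>b\<^sub>i\<close>, it consists of the combinations of the \<open>b\<^sub>i\<close> with
  coefficients in \<open>X\<close>, taken modulo \<open>J\<close>.\<close>

primrec sum_images :: "'c set \<Rightarrow> (nat \<Rightarrow> 'c \<Rightarrow> 'c) \<Rightarrow> 'c set \<Rightarrow> nat \<Rightarrow> 'c set"
  where
    "sum_images J \<phi> X 0 = J"
  | "sum_images J \<phi> X (Suc k) = sum_images J \<phi> X k <+>\<^bsub>V\<^esub> \<phi> k ` X"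

lemma submodule_sum_images:
  assumes "submodule K J V" "submodule K X V" "\<And>i. i < k \<Longrightarrow> \<phi> i \<in> module_hom K V V"
  shows "submodule K (sum_images J \<phi> X k) V"
  using assms(3)
  by (induction k) (auto intro!: submodule_set_add submodule_image assms(1,2))

lemma sum_images_mono: "X \<subseteq> Y \<Longrightarrow> sum_images J \<phi> X k \<subseteq> sum_images J \<phi> Y k"
  by (induction k) (simp_all add: set_add_mono image_mono)

lemma sum_images_base:
  assumes "submodule K J V" "submodule K X V" "\<And>i. i < k \<Longrightarrow> \<phi> i \<in> module_hom K V V"
  shows "J \<subseteq> sum_images J \<phi> X k"
  using assms(3)
proof (induction k)
  case (Suc k)
  have "submodule K (sum_images J \<phi> X k) V"
    by (rule submodule_sum_images) (use assms Suc in auto)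
  then show ?case
    using Suc set_add_upper(1)[of "sum_images J \<phi> X k" "\<phi> k ` X"] submodule_image[OF assms(2), of "\<phi> k"]
    by fastforce
qed simp

lemma sum_images_least:
  assumes "submodule K Z V" "J \<subseteq> Z" "\<And>i. i < k \<Longrightarrow> \<phi> i ` X \<subseteq> Z"
  shows "sum_images J \<phi> X k \<subseteq> Z"
  using assms(3)
proof (induction k)
  case (Suc k)
  have "sum_images J \<phi> X k <+>\<^bsub>V\<^esub> \<phi> k ` X \<subseteq> Z"
    by (rule set_add_least[OF assms(1)]) (use Suc in auto)
  then show ?case by simp
qed (simp add: assms)

text \<open>Replacing \<open>X\<close> by \<open>Y\<close> in one summand after the other costs at most \<open>d\<close> generators each
  time.\<close>

lemma generated_over_sum_images:
  assumes J: "submodule K J V" and X: "submodule K X V" and Y: "submodule K Y V" and "X \<subseteq> Y"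
    and "\<And>i. i < k \<Longrightarrow> \<phi> i \<in> module_hom K V V" and "generated_over d X Y"
  shows "generated_over (k * d) (sum_images J \<phi> X k) (sum_images J \<phi> Y k)"
  using assms(5)
proof (induction k)
  case 0
  then show ?case by simp
next
  case (Suc k)
  let ?X = "sum_images J \<phi> X k" and ?Y = "sum_images J \<phi> Y k"
  have hom: "\<phi> k \<in> module_hom K V V" using Suc.prems by simp
  have SX: "submodule K ?X V" and SY: "submodule K ?Y V"
    using submodule_sum_images J X Y Suc.prems by (metis less_Suc_eq)+
  have IX: "submodule K (\<phi> k ` X) V" and IY: "submodule K (\<phi> k ` Y) V"
    using submodule_image X Y hom by blast+
  have XY: "?X \<subseteq> ?Y" by (rule sum_images_mono) fact
  have S: "submodule K (?X <+>\<^bsub>V\<^esub> \<phi> k ` X) V" "submodule K (?Y <+>\<^bsub>V\<^esub> \<phi> k ` X) V"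
    "submodule K (?Y <+>\<^bsub>V\<^esub> \<phi> k ` Y) V"
    using submodule_set_add SX SY IX IY by blast+
  have "generated_over (k * d) (?X <+>\<^bsub>V\<^esub> \<phi> k ` X) ((?X <+>\<^bsub>V\<^esub> \<phi> k ` X) <+>\<^bsub>V\<^esub> (\<lambda>x. x) ` ?Y)"
    using set_add_upper[OF SX IX] Suc
    by (intro generated_over_image[OF SX SY S(1) id_module_hom]) auto
  also have "(?X <+>\<^bsub>V\<^esub> \<phi> k ` X) <+>\<^bsub>V\<^esub> (\<lambda>x. x) ` ?Y = ?Y <+>\<^bsub>V\<^esub> \<phi> k ` X"
  proof
    show "(?X <+>\<^bsub>V\<^esub> \<phi> k ` X) <+>\<^bsub>V\<^esub> (\<lambda>x. x) ` ?Y \<subseteq> ?Y <+>\<^bsub>V\<^esub> \<phi> k ` X"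
      using set_add_upper[OF SY IX] XY by (intro set_add_least[OF S(2)]) (auto simp: set_add_mono)
    show "?Y <+>\<^bsub>V\<^esub> \<phi> k ` X \<subseteq> (?X <+>\<^bsub>V\<^esub> \<phi> k ` X) <+>\<^bsub>V\<^esub> (\<lambda>x. x) ` ?Y"
      using set_add_upper[OF S(1) SY] set_add_upper[OF SX IX]
      by (intro set_add_least) (auto simp: submodule_set_add[OF S(1) SY])
  qed
  finally have 1: "generated_over (k * d) (?X <+>\<^bsub>V\<^esub> \<phi> k ` X) (?Y <+>\<^bsub>V\<^esub> \<phi> k ` X)" .
  have "generated_over d (?Y <+>\<^bsub>V\<^esub> \<phi> k ` X) ((?Y <+>\<^bsub>V\<^esub> \<phi> k ` X) <+>\<^bsub>V\<^esub> \<phi> k ` Y)"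
    using set_add_upper[OF SY IX] assms(6) by (intro generated_over_image[OF X Y S(2) hom]) auto
  also have "(?Y <+>\<^bsub>V\<^esub> \<phi> k ` X) <+>\<^bsub>V\<^esub> \<phi> k ` Y = ?Y <+>\<^bsub>V\<^esub> \<phi> k ` Y"
  proof
    show "(?Y <+>\<^bsub>V\<^esub> \<phi> k ` X) <+>\<^bsub>V\<^esub> \<phi> k ` Y \<subseteq> ?Y <+>\<^bsub>V\<^esub> \<phi> k ` Y"
      using set_add_upper[OF SY IY] \<open>X \<subseteq> Y\<close>
      by (intro set_add_least[OF S(3)] set_add_mono) auto
    show "?Y <+>\<^bsub>V\<^esub> \<phi> k ` Y \<subseteq> (?Y <+>\<^bsub>V\<^esub> \<phi> k ` X) <+>\<^bsub>V\<^esub> \<phi> k ` Y"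
      using set_add_upper(1)[OF SY IX] by (intro set_add_mono) auto
  qed
  finally have 2: "generated_over d (?Y <+>\<^bsub>V\<^esub> \<phi> k ` X) (?Y <+>\<^bsub>V\<^esub> \<phi> k ` Y)" .
  show ?case
    using generated_over_trans[OF S(1,2,3) _ 1 2] \<open>X \<subseteq> Y\<close>
    by (simp add: set_add_mono image_mono add.commute)
qed

text \<open>The converse estimate. The maps \<open>\<phi>\<^sub>i\<close> are assumed to vanish on \<open>I\<close> modulo \<open>J\<close> and to be
  independent otherwise: \<open>\<phi>\<^sub>i y\<close> is congruent to a sum of values of the earlier maps only for
  \<open>y \<in> I\<close>. So replacing \<open>X\<close> by \<open>Y\<close> in one summand leaves a quotient isomorphic to \<open>Y/X\<close>, and \<open>generated_over_split\<close> adds up the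
  contributions.\<close>

lemma rank_over_sum_images:
  assumes J: "submodule K J V" and I: "submodule K I V" and X: "submodule K X V" and Y: "submodule K Y V"
    and "I \<subseteq> X" "X \<subseteq> Y"
    and "\<And>i. i < k \<Longrightarrow> \<phi> i \<in> module_hom K V V"
    and "\<And>i. i < k \<Longrightarrow> \<phi> i ` I \<subseteq> J"
    and "\<And>i y. \<lbrakk>i < k; y \<in> carrier V; \<phi> i y \<in> sum_images J \<phi> (carrier V) i\<rbrakk> \<Longrightarrow> y \<in> I"
    and "generated_over n (sum_images J \<phi> X k) (sum_images J \<phi> Y k)"
  shows "k * rank_over X Y \<le> n"
  using assms(7-10)
proof (induction k arbitrary: n)
  case 0
  then show ?case by simp
next
  case (Suc k)
  let ?X = "sum_images J \<phi> X k" and ?Y = "sum_images J \<phi> Y k" and ?A = "sum_images J \<phi> (carrier V) k"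
  have hom: "\<phi> k \<in> module_hom K V V" using Suc.prems by simp
  have homs: "\<phi> i \<in> module_hom K V V" if "i < k" for i using Suc.prems that by simp
  interpret mod_hom K V V "\<phi> k" by unfold_locales (rule hom)
  have SX: "submodule K ?X V" and SY: "submodule K ?Y V" and SA: "submodule K ?A V"
    using submodule_sum_images[OF J _ homs] X Y submodule_carrier by auto
  have IX: "submodule K (\<phi> k ` X) V" and IY: "submodule K (\<phi> k ` Y) V"
    using submodule_image X Y hom by blast+
  have XY: "?X \<subseteq> ?Y" by (rule sum_images_mono) fact
  have YA: "?Y \<subseteq> ?A" by (rule sum_images_mono) (rule submoduleD(1)[OF Y])
  have S: "submodule K (?X <+>\<^bsub>V\<^esub> \<phi> k ` X) V" "submodule K (?Y <+>\<^bsub>V\<^esub> \<phi> k ` X) V"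
    "submodule K (?Y <+>\<^bsub>V\<^esub> \<phi> k ` Y) V"
    using submodule_set_add SX SY IX IY by blast+
  have indep: "y \<in> I" if "y \<in> carrier V" "\<phi> k y \<in> ?A" for y
    using Suc.prems(3)[of k y] that by simp
  have Xc: "x \<in> carrier V" if "x \<in> X" for x using that submoduleD(1)[OF X] by auto
  have Yc: "x \<in> carrier V" if "x \<in> Y" for x using that submoduleD(1)[OF Y] by auto
  have SYc: "x \<in> carrier V" if "x \<in> ?Y" for x using that submoduleD(1)[OF SY] by auto
  have inc: "?X <+>\<^bsub>V\<^esub> \<phi> k ` X \<subseteq> ?Y <+>\<^bsub>V\<^esub> \<phi> k ` X" "?Y <+>\<^bsub>V\<^esub> \<phi> k ` X \<subseteq> ?Y <+>\<^bsub>V\<^esub> \<phi> k ` Y"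
    by (rule set_add_mono[OF XY order_refl], rule set_add_mono[OF order_refl image_mono[OF \<open>X \<subseteq> Y\<close>]])
  obtain a b where ab: "a + b \<le> n" "generated_over a (?X <+>\<^bsub>V\<^esub> \<phi> k ` X) (?Y <+>\<^bsub>V\<^esub> \<phi> k ` X)"
      "generated_over b (?Y <+>\<^bsub>V\<^esub> \<phi> k ` X) (?Y <+>\<^bsub>V\<^esub> \<phi> k ` Y)"
    using generated_over_split[OF S(1,2,3) inc, of n] Suc.prems(4) unfolding sum_images.simps by blast
  have "generated_over a ?X ?Y"
  proof (rule generated_over_preimage[OF S(1,2) SX SY id_module_hom ab(2)])
    fix z assume z: "z \<in> ?Y"
    show "z \<in> ?X <+>\<^bsub>V\<^esub> \<phi> k ` X \<longleftrightarrow> z \<in> ?X"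
    proof
      assume "z \<in> ?X <+>\<^bsub>V\<^esub> \<phi> k ` X"
      then obtain w x where w: "w \<in> ?X" "x \<in> X" "z = w \<oplus>\<^bsub>V\<^esub> \<phi> k x" by (auto elim!: set_add_memE)
      have wc: "w \<in> carrier V" "\<phi> k x \<in> carrier V" using w XY SYc Xc f_im by blast+
      have "\<ominus>\<^bsub>V\<^esub> w \<oplus>\<^bsub>V\<^esub> z \<in> ?A"
        using w z XY YA submoduleD(3,5)[OF SA] by blast
      then have "\<phi> k x \<in> ?A" using w(3) wc by (simp add: module.M.r_neg1)
      then have "\<phi> k x \<in> J" using indep[OF Xc[OF w(2)]] Suc.prems(2)[of k] by auto
      then have "\<phi> k x \<in> ?X" using sum_images_base[OF J X, of k \<phi>] homs by blast
      then show "z \<in> ?X" using w submoduleD(3)[OF SX] by blast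
    qed (use set_add_upper[OF SX IX] in auto)
  next
    show "?X \<subseteq> ?Y" by (rule XY)
    show "(\<lambda>x. x) ` ?Y \<subseteq> ?Y <+>\<^bsub>V\<^esub> \<phi> k ` X" using set_add_upper[OF SY IX] by simp
    show "?Y <+>\<^bsub>V\<^esub> \<phi> k ` X \<subseteq> (?X <+>\<^bsub>V\<^esub> \<phi> k ` X) <+>\<^bsub>V\<^esub> (\<lambda>x. x) ` ?Y"
      using set_add_upper[OF S(1) SY] set_add_upper[OF SX IX]
      by (intro set_add_least) (auto simp: submodule_set_add[OF S(1) SY])
  qed
  then have a: "k * rank_over X Y \<le> a"
    using Suc.IH[of a] Suc.prems by (metis less_Suc_eq)
  have "generated_over b X Y"
  proof (rule generated_over_preimage[OF S(2,3) X Y hom ab(3)])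
    fix y assume y: "y \<in> Y"
    show "\<phi> k y \<in> ?Y <+>\<^bsub>V\<^esub> \<phi> k ` X \<longleftrightarrow> y \<in> X"
    proof
      assume "\<phi> k y \<in> ?Y <+>\<^bsub>V\<^esub> \<phi> k ` X"
      then obtain w x where w: "w \<in> ?Y" "x \<in> X" "\<phi> k y = w \<oplus>\<^bsub>V\<^esub> \<phi> k x" by (auto elim!: set_add_memE)
      have wc: "w \<in> carrier V" "\<phi> k x \<in> carrier V" using w SYc Xc f_im by blast+
      have "\<phi> k (y \<ominus>\<^bsub>V\<^esub> x) = \<phi> k y \<ominus>\<^bsub>V\<^esub> \<phi> k x" by (rule f_minus[OF Yc[OF y] Xc[OF w(2)]])
      also have "\<dots> = w" using w(3) wc by (simp add: a_minus_def module.M.a_assoc module.M.r_neg)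
      finally have "\<phi> k (y \<ominus>\<^bsub>V\<^esub> x) \<in> ?A" using w YA by auto
      then have "y \<ominus>\<^bsub>V\<^esub> x \<in> X" using indep[of "y \<ominus>\<^bsub>V\<^esub> x"] Yc[OF y] Xc[OF w(2)] \<open>I \<subseteq> X\<close> by auto
      then have "(y \<ominus>\<^bsub>V\<^esub> x) \<oplus>\<^bsub>V\<^esub> x \<in> X" using submoduleD(3)[OF X] w by blast
      then show "y \<in> X" using Yc[OF y] Xc[OF w(2)]
        by (simp add: a_minus_def module.M.a_assoc module.M.l_neg)
    qed (use set_add_upper[OF SY IX] in auto)
  next
    show "X \<subseteq> Y" by fact
    show "\<phi> k ` Y \<subseteq> ?Y <+>\<^bsub>V\<^esub> \<phi> k ` Y" using set_add_upper[OF SY IY] by simp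
    show "?Y <+>\<^bsub>V\<^esub> \<phi> k ` Y \<subseteq> (?Y <+>\<^bsub>V\<^esub> \<phi> k ` X) <+>\<^bsub>V\<^esub> \<phi> k ` Y"
      using set_add_upper(1)[OF SY IX] by (intro set_add_mono) auto
  qed
  then have "rank_over X Y \<le> b" by (rule rank_over_le)
  then show ?case using a ab(1) by simp
qed

lemma abelian_subgroup_submodule: "submodule K U V \<Longrightarrow> abelian_subgroup U V"
proof -
  assume U: "submodule K U V"
  have "subgroup U (add_monoid V)"
    by (rule module.M.add.subgroupI) (use submoduleD[OF U] in auto)
  then show ?thesis
    by (intro abelian_subgroupI3 additive_subgroupI module.M.abelian_group_axioms)
qed

lemma coset_eq_iff:
  assumes "submodule K U V" "x \<in> carrier V" "y \<in> carrier V"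
  shows "U +>\<^bsub>V\<^esub> x = U +>\<^bsub>V\<^esub> y \<longleftrightarrow> x \<ominus>\<^bsub>V\<^esub> y \<in> U"
proof -
  interpret U: abelian_subgroup U V by (rule abelian_subgroup_submodule) fact
  show ?thesis
    using U.a_rcos_module[of y x] U.a_rcos_self[of x] U.a_repr_independence'[of x y] assms
    by (auto simp: a_minus_def)
qed

lemma quotient_space_simps:
  "carrier (quotient_space V W U) = (\<lambda>x. U +>\<^bsub>V\<^esub> x) ` W"
  "zero (quotient_space V W U) = U"
  "add (quotient_space V W U) = set_add V"
  by (simp_all add: quotient_space_def subquotient_def)

lemma quotient_space_smult:
  assumes U: "submodule K U V" and c: "c \<in> carrier K" and x: "x \<in> carrier V"
  shows "c \<odot>\<^bsub>quotient_space V W U\<^esub> (U +>\<^bsub>V\<^esub> x) = U +>\<^bsub>V\<^esub> (c \<odot>\<^bsub>V\<^esub> x)"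
proof -
  interpret U: abelian_subgroup U V by (rule abelian_subgroup_submodule) fact
  have "U +>\<^bsub>V\<^esub> (c \<odot>\<^bsub>V\<^esub> y) = U +>\<^bsub>V\<^esub> (c \<odot>\<^bsub>V\<^esub> x)" if y: "y \<in> U +>\<^bsub>V\<^esub> x" for y
  proof -
    have yc: "y \<in> carrier V" using U.a_elemrcos_carrier[OF x y] .
    have "y \<ominus>\<^bsub>V\<^esub> x \<in> U" using U.a_rcos_module_imp[OF x y] by (simp add: a_minus_def)
    then have "c \<odot>\<^bsub>V\<^esub> (y \<ominus>\<^bsub>V\<^esub> x) \<in> U" by (rule submoduleD(4)[OF U c])
    moreover have "c \<odot>\<^bsub>V\<^esub> (y \<ominus>\<^bsub>V\<^esub> x) = c \<odot>\<^bsub>V\<^esub> y \<ominus>\<^bsub>V\<^esub> c \<odot>\<^bsub>V\<^esub> x"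
      using c x yc by (simp add: a_minus_def smult_r_distr smult_r_minus)
    ultimately show ?thesis using coset_eq_iff[OF U] c x yc by simp
  qed
  then have "(\<Union>y\<in>U +>\<^bsub>V\<^esub> x. U +>\<^bsub>V\<^esub> (c \<odot>\<^bsub>V\<^esub> y)) = (\<Union>y\<in>U +>\<^bsub>V\<^esub> x. U +>\<^bsub>V\<^esub> (c \<odot>\<^bsub>V\<^esub> x))"
    by (intro SUP_cong refl)
  also have "\<dots> = U +>\<^bsub>V\<^esub> (c \<odot>\<^bsub>V\<^esub> x)" using U.a_rcos_self[OF x] by blast
  finally show ?thesis by (simp add: quotient_space_def subquotient_def)
qed

lemma vectorspace_quotient_space:
  assumes U: "submodule K U V" and W: "submodule K W V"
  shows "vectorspace K (quotient_space V W U)"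
proof -
  interpret U: abelian_subgroup U V by (rule abelian_subgroup_submodule) fact
  let ?Q = "quotient_space V W U"
  have Wc: "x \<in> carrier V" if "x \<in> W" for x using that submoduleD(1)[OF W] by auto
  note rules = quotient_space_simps quotient_space_smult[OF U] U.a_rcos_sum
  have 0: "U = U +>\<^bsub>V\<^esub> \<zero>\<^bsub>V\<^esub>" using U.a_rcos_const[of "\<zero>\<^bsub>V\<^esub>"] by simp
  have "module K ?Q"
  proof (rule module_criteria)
    show "cring K" by unfold_locales
    show "\<zero>\<^bsub>?Q\<^esub> \<in> carrier ?Q" using 0 submoduleD(2)[OF W] by (auto simp: rules)
    show "\<forall>v w. v \<in> carrier ?Q \<and> w \<in> carrier ?Q \<longrightarrow> v \<oplus>\<^bsub>?Q\<^esub> w \<in> carrier ?Q"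
      using submoduleD(3)[OF W] Wc by (auto simp: rules)
    show "\<forall>v\<in>carrier ?Q. \<exists>w\<in>carrier ?Q. v \<oplus>\<^bsub>?Q\<^esub> w = \<zero>\<^bsub>?Q\<^esub>"
    proof
      fix v assume "v \<in> carrier ?Q"
      then obtain x where x: "x \<in> W" "v = U +>\<^bsub>V\<^esub> x" by (auto simp: rules)
      then have "v \<oplus>\<^bsub>?Q\<^esub> (U +>\<^bsub>V\<^esub> (\<ominus>\<^bsub>V\<^esub> x)) = U"
        using Wc 0 by (simp add: rules module.M.r_neg)
      then show "\<exists>w\<in>carrier ?Q. v \<oplus>\<^bsub>?Q\<^esub> w = \<zero>\<^bsub>?Q\<^esub>"
        using submoduleD(5)[OF W x(1)] by (auto simp: rules)
    qed
    show "\<forall>c v. c \<in> carrier K \<and> v \<in> carrier ?Q \<longrightarrow> c \<odot>\<^bsub>?Q\<^esub> v \<in> carrier ?Q"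
      using submoduleD(4)[OF W] Wc by (auto simp: rules)
    show "\<forall>v w. v \<in> carrier ?Q \<and> w \<in> carrier ?Q \<longrightarrow> v \<oplus>\<^bsub>?Q\<^esub> w = w \<oplus>\<^bsub>?Q\<^esub> v"
      using Wc by (auto simp: rules module.M.a_comm)
    show "\<forall>v w x. v \<in> carrier ?Q \<and> w \<in> carrier ?Q \<and> x \<in> carrier ?Q \<longrightarrow>
        v \<oplus>\<^bsub>?Q\<^esub> w \<oplus>\<^bsub>?Q\<^esub> x = v \<oplus>\<^bsub>?Q\<^esub> (w \<oplus>\<^bsub>?Q\<^esub> x)"
      using Wc by (auto simp: rules module.M.a_assoc)
    show "\<forall>v\<in>carrier ?Q. v \<oplus>\<^bsub>?Q\<^esub> \<zero>\<^bsub>?Q\<^esub> = v"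
    proof
      fix v assume "v \<in> carrier ?Q"
      then obtain x where x: "x \<in> W" "v = U +>\<^bsub>V\<^esub> x" by (auto simp: rules)
      have "v \<oplus>\<^bsub>?Q\<^esub> (U +>\<^bsub>V\<^esub> \<zero>\<^bsub>V\<^esub>) = v"
        using x Wc U.a_rcos_sum[of x "\<zero>\<^bsub>V\<^esub>"] by (metis module.M.r_zero module.M.zero_closed quotient_space_simps(3))
      then show "v \<oplus>\<^bsub>?Q\<^esub> \<zero>\<^bsub>?Q\<^esub> = v" using 0 by (simp add: rules)
    qed
  qed (use Wc in \<open>auto simp: rules smult_assoc1 smult_l_distr smult_r_distr\<close>)
  then show ?thesis by (simp add: vectorspace_def field.field_axioms)
qed

text \<open>Representatives of a finite spanning set of the quotient space are adjoined to \<open>U\<close>. The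
  image of the resulting \<open>Z\<close> is a submodule of the quotient that contains the spanning set, hence
  all of it.\<close>

lemma fin_dim_quotient_generated_over:
  assumes U: "submodule K U V" and W: "submodule K W V" and "U \<subseteq> W"
    and "vectorspace.fin_dim K (quotient_space V W U)"
  shows "\<exists>n. generated_over n U W"
proof -
  let ?Q = "quotient_space V W U"
  interpret Q: vectorspace K ?Q by (rule vectorspace_quotient_space[OF U W])
  interpret U: abelian_subgroup U V by (rule abelian_subgroup_submodule) fact
  have Wc: "x \<in> carrier V" if "x \<in> W" for x using that submoduleD(1)[OF W] by auto
  note rules = quotient_space_simps quotient_space_smult[OF U] U.a_rcos_sum
  obtain A where A: "finite A" "A \<subseteq> carrier ?Q" "Q.span A = carrier ?Q"
    using assms(4) unfolding Q.fin_dim_def by blast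
  from A(1,2) have "\<exists>n Z. submodule K Z V \<and> U \<subseteq> Z \<and> Z \<subseteq> W \<and> generated_over n U Z \<and>
      A \<subseteq> (\<lambda>x. U +>\<^bsub>V\<^esub> x) ` Z"
  proof (induction A rule: finite_induct)
    case empty
    show ?case by (intro exI[of _ 0] exI[of _ U]) (use U \<open>U \<subseteq> W\<close> in auto)
  next
    case (insert a A)
    then obtain n Z where Z: "submodule K Z V" "U \<subseteq> Z" "Z \<subseteq> W" "generated_over n U Z"
      "A \<subseteq> (\<lambda>x. U +>\<^bsub>V\<^esub> x) ` Z" by auto
    obtain x where x: "x \<in> W" "a = U +>\<^bsub>V\<^esub> x" using insert.prems by (auto simp: rules)
    have Z': "submodule K (adjoin Z x) V" by (rule submodule_adjoin[OF Z(1) Wc[OF x(1)]])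
    note up = adjoin_upper[OF Z(1) Wc[OF x(1)]]
    have "generated_over (Suc 0) Z (adjoin Z x)" using up(2) by auto
    then have "generated_over (n + Suc 0) U (adjoin Z x)"
      using generated_over_trans[OF U Z(1) Z' up(1) Z(4)] by blast
    moreover have "adjoin Z x \<subseteq> W" by (rule adjoin_least[OF W Z(3) x(1)])
    ultimately show ?case
      using Z' Z up x by (intro exI[of _ "n + Suc 0"] exI[of _ "adjoin Z x"]) blast
  qed
  then obtain n Z where Z: "submodule K Z V" "U \<subseteq> Z" "Z \<subseteq> W" "generated_over n U Z"
      "A \<subseteq> (\<lambda>x. U +>\<^bsub>V\<^esub> x) ` Z" by blast
  have Zc: "x \<in> carrier V" if "x \<in> Z" for x using that submoduleD(1)[OF Z(1)] by auto
  have "submodule K ((\<lambda>x. U +>\<^bsub>V\<^esub> x) ` Z) ?Q"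
  proof (rule Q.submoduleI)
    show "(+>\<^bsub>V\<^esub>) U ` Z \<subseteq> carrier ?Q" using Z(3) by (auto simp: rules)
    show "\<zero>\<^bsub>?Q\<^esub> \<in> (+>\<^bsub>V\<^esub>) U ` Z"
      using U.a_rcos_const[of "\<zero>\<^bsub>V\<^esub>"] submoduleD(2)[OF Z(1)] by (auto simp: rules)
  qed (use Zc submoduleD(3,4)[OF Z(1)] in \<open>auto simp: rules\<close>)
  then have "carrier ?Q \<subseteq> (\<lambda>x. U +>\<^bsub>V\<^esub> x) ` Z"
    using Q.span_is_subset[OF Z(5)] A(3) by simp
  then have "W \<subseteq> Z"
  proof (intro subsetI)
    fix x assume x: "x \<in> W" and *: "carrier ?Q \<subseteq> (\<lambda>x. U +>\<^bsub>V\<^esub> x) ` Z"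
    then obtain z where z: "z \<in> Z" "U +>\<^bsub>V\<^esub> x = U +>\<^bsub>V\<^esub> z" by (auto simp: rules)
    then have "x \<ominus>\<^bsub>V\<^esub> z \<in> Z" using coset_eq_iff[OF U Wc[OF x] Zc[OF z(1)]] Z(2) by blast
    then have "(x \<ominus>\<^bsub>V\<^esub> z) \<oplus>\<^bsub>V\<^esub> z \<in> Z" using submoduleD(3)[OF Z(1)] z by blast
    then show "x \<in> Z" using Wc[OF x] Zc[OF z(1)] 
      by (simp add: a_minus_def module.M.a_assoc module.M.l_neg)
  qed
  then have "W = Z" using Z(3) by (rule equalityI)
  then show ?thesis using Z(4) by blast
qed

end

section \<open>Numerical sequences of exponential growth\<close>

text \<open>The index is the first one at which \<open>h n / r\<^sup>n\<close> exceeds both \<open>0\<close> and its maximum over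
  \<open>{..N}\<close>. It lies beyond \<open>N\<close>, and all earlier ratios are smaller.\<close>

lemma record_indices:
  fixes h :: "nat \<Rightarrow> real"
  assumes "r > 1" and unbounded: "\<And>C. \<exists>n. h n > C * r ^ n"
  shows "\<exists>n>N. h n > 0 \<and> (\<forall>d\<le>n. h (n - d) \<le> h n * (1 / r) ^ d)"
proof -
  have r: "r ^ n > 0" for n using \<open>r > 1\<close> by simp
  define C where "C = Max (insert 0 ((\<lambda>m. h m / r ^ m) ` {..N}))"
  define n where "n = (LEAST n. h n > C * r ^ n)"
  have n: "h n > C * r ^ n" unfolding n_def using unbounded[of C] by (rule LeastI_ex)
  have less: "h m \<le> C * r ^ m" if "m < n" for m
    using not_less_Least[OF that[unfolded n_def]] by simp
  have C0: "C \<ge> 0" unfolding C_def by (rule Max_ge) auto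
  have "n > N"
  proof (rule ccontr)
    assume "\<not> n > N"
    then have "h n / r ^ n \<le> C" unfolding C_def by (intro Max_ge) auto
    then show False using n r[of n] by (simp add: field_simps)
  qed
  moreover have "h n > 0" using n C0 r[of n] by (smt (verit) mult_nonneg_nonneg)
  moreover have "h (n - d) \<le> h n * (1 / r) ^ d" if "d \<le> n" for d
  proof (cases "d = 0")
    case False
    then have "h (n - d) \<le> C * r ^ (n - d)" using less that by simp
    also have "\<dots> = C * r ^ n * (1 / r) ^ d"
      using that \<open>r > 1\<close> by (simp add: power_diff power_one_over field_simps)
    also have "\<dots> \<le> h n * (1 / r) ^ d"
      using n r[of d] \<open>r > 1\<close> by (intro mult_right_mono) auto
    finally show ?thesis .
  qed simp
  ultimately show ?thesis by blast
qed

text \<open>For a record index \<open>n\<close> of \<open>h n / r\<^sup>n\<close>, passing from \<open>n\<close> to \<open>n - d\<close> reduces \<open>h\<close> at least by the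
  factor \<open>r\<^sup>-\<^sup>d\<close>. If the record indices \<open>d\<^sub>i\<close> are so sparse that
  \<open>r\<close> to the power \<open>-d\<^sub>i\<close> is less than \<open>2\<close> to the power \<open>-i-1\<close>, these factors have sum less than \<open>1\<close>.\<close>

lemma lacunary_sequence:
  fixes h :: "nat \<Rightarrow> nat"
  assumes "r > (1::real)" and unbounded: "\<And>C. \<exists>n. real (h n) > C * r ^ n"
  shows "\<exists>d :: nat \<Rightarrow> nat. (\<forall>i k. i < k \<longrightarrow> d i < d k) \<and> (\<forall>k. (\<Sum>i<k. h (d k - d i)) < h (d k))"
proof -
  have r: "0 < 1 / r" "1 / r < 1" using \<open>r > 1\<close> by auto
  define P where "P k y \<longleftrightarrow> h y > 0 \<and> (\<forall>e\<le>y. real (h (y - e)) \<le> real (h y) * (1 / r) ^ e) \<and>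
      (1 / r) ^ y < (1 / 2) ^ Suc k" for k y
  have step: "\<exists>y. P k y \<and> x < y" for k x
  proof -
    obtain N where N: "(1 / r) ^ N < (1 / 2 :: real) ^ Suc k"
      using real_arch_pow_inv[of "(1 / 2 :: real) ^ Suc k" "1 / r"] r(2) by auto
    obtain y where y: "y > max N x" "h y > 0" "\<forall>e\<le>y. real (h (y - e)) \<le> real (h y) * (1 / r) ^ e"
      using record_indices[OF assms(1), of "\<lambda>n. real (h n)" "max N x"] unbounded by auto
    have "(1 / r) ^ y \<le> (1 / r) ^ N" using y(1) r by (intro power_decreasing) auto
    then have "P k y" unfolding P_def using N y(2,3) by (auto intro: le_less_trans)
    then show ?thesis using y(1) by auto
  qed
  have "\<exists>d. \<forall>k. P k (d k) \<and> d k < d (Suc k)"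
  proof (rule dependent_nat_choice)
    show "\<exists>x. P 0 x" using step by blast
    show "\<exists>y. P (Suc k) y \<and> x < y" for x k by (rule step)
  qed
  then obtain d where P: "\<And>k. P k (d k)" and d_Suc: "\<And>k. d k < d (Suc k)" by blast
  have d: "h (d k) > 0" "e \<le> d k \<Longrightarrow> real (h (d k - e)) \<le> real (h (d k)) * (1 / r) ^ e"
    "(1 / r) ^ d k < (1 / 2) ^ Suc k" for k e
    using P[of k] unfolding P_def by blast+
  have mono: "d i < d k" if "i < k" for i k
    using d_Suc that by (rule lift_Suc_mono_less)
  have "(\<Sum>i<k. h (d k - d i)) < h (d k)" for k
  proof -
    \<comment> \<open>The geometric bounds on the factors add up to less than \<open>1\<close>.\<close>
  have geo: "(\<Sum>i<k. (1 / 2) ^ Suc i) = 1 - (1 / 2 :: real) ^ k" by (induction k) auto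
    have "real (\<Sum>i<k. h (d k - d i)) \<le> (\<Sum>i<k. real (h (d k)) * (1 / 2) ^ Suc i)"
      unfolding of_nat_sum
    proof (rule sum_mono)
      fix i assume "i \<in> {..<k}"
      then have "real (h (d k - d i)) \<le> real (h (d k)) * (1 / r) ^ d i"
        using d(2)[of "d i" k] mono[of i k] by simp
      also have "\<dots> \<le> real (h (d k)) * (1 / 2) ^ Suc i"
        using d(3)[of i] by (intro mult_left_mono) auto
      finally show "real (h (d k - d i)) \<le> real (h (d k)) * (1 / 2) ^ Suc i" .
    qed
    also have "\<dots> = real (h (d k)) * (1 - (1 / 2) ^ k)"
      unfolding geo[symmetric] sum_distrib_left ..
    also have "\<dots> < real (h (d k))" using d(1)[of k] by (simp add: right_diff_distrib)
    finally show ?thesis by linarith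
  qed
  then show ?thesis using mono by blast
qed

lemma linear_times_geometric_not_bounded_below:
  fixes q a b :: real
  assumes "q > 1"
  shows "\<exists>k::nat. a + b * real k < q ^ k"
proof -
  have "(\<lambda>k::nat. (a + b * real k) / q ^ k) \<longlonglongrightarrow> a * 0 + b * 0"
  proof -
    have 1: "(\<lambda>k. (1 / q) ^ k) \<longlonglongrightarrow> 0" using assms by (intro LIMSEQ_power_zero) auto
    have 2: "(\<lambda>k. real k * (1 / q) ^ k) \<longlonglongrightarrow> 0" using assms by (intro powser_times_n_limit_0) auto
    show ?thesis
      using tendsto_add[OF tendsto_mult_left[OF 1, of a] tendsto_mult_left[OF 2, of b]]
      by (simp add: power_one_over add_divide_distrib)
  qed
  then have "\<forall>\<^sub>F k in sequentially. (a + b * real k) / q ^ k < 1"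
    by (intro order_tendstoD(2)) auto
  then obtain k where "(a + b * real k) / q ^ k < 1" by (auto simp: eventually_sequentially)
  then show ?thesis using assms by (intro exI[of _ k]) (simp add: field_simps)
qed

text \<open>Iterating the inequality \<open>step\<close> from a positive value gives growth like \<open>q\<^sup>k\<close> along intervals
  whose length is linear in \<open>k\<close>, whereas summing the subexponential bounds over such an interval
  gives much less. The ratio \<open>t/s\<close> is replaced by \<open>q = (2s+2)/(2s+1)\<close>, which makes sense also
  for \<open>s = 0\<close>.\<close>

lemma subexponential_rank_contradiction:
  fixes D :: "int \<Rightarrow> int \<Rightarrow> nat" and g :: "int \<Rightarrow> nat" and c s t :: nat
  assumes sum: "\<And>m n. m \<le> n \<Longrightarrow> D m n \<le> (\<Sum>i\<in>{m<..n}. g i)"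
    and step: "\<And>m n. m \<le> n \<Longrightarrow> t * D m n \<le> s * D (m - int c) (n + int c)"
    and "s < t" and "m\<^sub>0 \<le> n\<^sub>0" and "D m\<^sub>0 n\<^sub>0 > 0"
    and subexp: "\<And>r::real. r > 1 \<Longrightarrow> \<exists>C. \<forall>i. real (g i) \<le> C * r ^ nat \<bar>i\<bar>"
  shows False
proof -
  define q where "q = (2 * real s + 2) / (2 * real s + 1)"
  have q: "q > 1" by (simp add: q_def field_simps)
  \<comment> \<open>This root makes \<open>(r\<^bsup>c+1\<^esup>)\<^sup>2 = q\<close>, so the upper bound of order \<open>r\<^bsup>ck\<^esup>\<close> stays below the square root of \<open>q\<^sup>k\<close>.\<close>
  define r where "r = root (2 * c + 2) q"
  have r: "r > 1" using q by (simp add: r_def)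
  have rq: "r ^ (2 * c + 2) = q" using q unfolding r_def by (intro real_root_pow_pos2) auto
  have r1: "r ^ (c + 1) > 1" using r by (intro one_less_power) auto
  obtain C where C: "\<And>i. real (g i) \<le> C * r ^ nat \<bar>i\<bar>" using subexp[OF r] by blast
  have C0: "C \<ge> 0" using C[of 0] by simp
  define u where "u k = D (m\<^sub>0 - int (c * k)) (n\<^sub>0 + int (c * k))" for k
  have le: "m\<^sub>0 - int (c * k) \<le> n\<^sub>0 + int (c * k)" for k
    using \<open>m\<^sub>0 \<le> n\<^sub>0\<close> of_nat_0_le_iff[of "c * k", where ?'a = int] by linarith
  have u_step: "q * real (u k) \<le> real (u (Suc k))" for k
  proof -
    have "t * u k \<le> s * u (Suc k)"
      using step[OF le[of k]] by (simp add: u_def algebra_simps)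
    then have "(2 * s + 2) * u k \<le> (2 * s + 1) * u (Suc k)"
      using mult_right_mono[of "s + 1" t "u k"] \<open>s < t\<close> by (simp add: algebra_simps)
    then have "real ((2 * s + 2) * u k) \<le> real ((2 * s + 1) * u (Suc k))" by (rule of_nat_mono)
    then show ?thesis by (simp add: q_def field_simps)
  qed
  have lower: "q ^ k \<le> real (u k)" for k
  proof (induction k)
    case 0
    then show ?case using \<open>D m\<^sub>0 n\<^sub>0 > 0\<close> by (simp add: u_def)
  next
    case (Suc k)
    have "q ^ Suc k \<le> q * real (u k)" using Suc q by simp
    then show ?case using u_step[of k] by linarith
  qed
  define e where "e = nat \<bar>m\<^sub>0\<bar> + nat \<bar>n\<^sub>0\<bar>"
  have e: "nat \<bar>i\<bar> \<le> e + p" if "i \<in> {m\<^sub>0 - int p<..n\<^sub>0 + int p}" for i p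
    using that by (simp add: e_def) linarith
  have upper: "real (u k) \<le> (real (nat (n\<^sub>0 - m\<^sub>0)) + 2 * real c * real k) * (C * r ^ e) * r ^ (c * k)" for k
  proof -
    let ?m = "m\<^sub>0 - int (c * k)" and ?n = "n\<^sub>0 + int (c * k)"
    have "real (u k) \<le> (\<Sum>i\<in>{?m<..?n}. real (g i))"
      using sum[OF le[of k]] unfolding u_def of_nat_sum[symmetric] by (simp only: of_nat_le_iff)
    also have "\<dots> \<le> (\<Sum>i\<in>{?m<..?n}. C * r ^ (e + c * k))"
    proof (rule sum_mono)
      fix i assume "i \<in> {?m<..?n}"
      then have "nat \<bar>i\<bar> \<le> e + c * k" by (rule e)
      then have "C * r ^ nat \<bar>i\<bar> \<le> C * r ^ (e + c * k)"
        using C0 r by (intro mult_left_mono power_increasing) auto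
      then show "real (g i) \<le> C * r ^ (e + c * k)" using C[of i] by linarith
    qed
    also have "\<dots> = (real (nat (n\<^sub>0 - m\<^sub>0)) + 2 * real c * real k) * (C * r ^ e) * r ^ (c * k)"
    proof -
      have "real (card {?m<..?n}) = real_of_int (?n - ?m)"
        using le[of k] by (simp only: card_greaterThanAtMost_int of_nat_nat diff_ge_0_iff_ge)
      also have "\<dots> = real (nat (n\<^sub>0 - m\<^sub>0)) + 2 * real c * real k"
        using \<open>m\<^sub>0 \<le> n\<^sub>0\<close> by simp
      finally show ?thesis by (simp add: power_add)
    qed
    finally show ?thesis .
  qed
  obtain k where k: "real (nat (n\<^sub>0 - m\<^sub>0)) * (C * r ^ e) + 2 * real c * (C * r ^ e) * real k < (r ^ (c + 1)) ^ k"
    using linear_times_geometric_not_bounded_below[OF r1] by blast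
  have "q ^ k \<le> (real (nat (n\<^sub>0 - m\<^sub>0)) + 2 * real c * real k) * (C * r ^ e) * r ^ (c * k)"
    using lower upper by (rule order_trans)
  also have "\<dots> < (r ^ (c + 1)) ^ k * r ^ (c * k)"
    using k r by (intro mult_strict_right_mono) (auto simp: algebra_simps)
  also have "\<dots> \<le> (r ^ (c + 1)) ^ k * r ^ ((c + 1) * k)"
    using r by (intro mult_left_mono power_increasing) auto
  also have "\<dots> = q ^ k"
    unfolding rq[symmetric] power_mult[symmetric] power_add[symmetric]
    by (rule arg_cong[of _ _ "power r"]) (simp add: algebra_simps)
  finally show False by simp
qed

section \<open>Maximal left ideals\<close>

text \<open>Negatives come for free as multiples by \<open>-1\<close>.\<close>

lemma (in ring) left_idealI:
  assumes "L \<subseteq> carrier R" "L \<noteq> {}"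
    and add: "\<And>x y. \<lbrakk>x \<in> L; y \<in> L\<rbrakk> \<Longrightarrow> x \<oplus> y \<in> L"
    and mult: "\<And>a x. \<lbrakk>a \<in> carrier R; x \<in> L\<rbrakk> \<Longrightarrow> a \<otimes> x \<in> L"
  shows "left_ideal L R"
proof -
  have "\<ominus> x \<in> L" if "x \<in> L" for x
  proof -
    have "(\<ominus> \<one>) \<otimes> x = \<ominus> x" using that assms(1) by (subst l_minus) auto
    then show ?thesis using mult[of "\<ominus> \<one>" x] that by simp
  qed
  then have "subgroup L (add_monoid R)"
    using assms by (intro add.subgroupI) auto
  then show ?thesis
    using mult by (intro left_ideal.intro additive_subgroupI left_ideal_axioms.intro ring_axioms) auto
qed

lemma left_idealD:
  assumes "left_ideal L R"
  shows "L \<subseteq> carrier R" "\<zero>\<^bsub>R\<^esub> \<in> L" "\<lbrakk>x \<in> L; y \<in> L\<rbrakk> \<Longrightarrow> x \<oplus>\<^bsub>R\<^esub> y \<in> L"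
    "\<lbrakk>a \<in> carrier R; x \<in> L\<rbrakk> \<Longrightarrow> a \<otimes>\<^bsub>R\<^esub> x \<in> L"
proof -
  interpret left_ideal L R by (rule assms)
  show "L \<subseteq> carrier R" by (rule a_subset)
  show "\<zero>\<^bsub>R\<^esub> \<in> L" "\<lbrakk>x \<in> L; y \<in> L\<rbrakk> \<Longrightarrow> x \<oplus>\<^bsub>R\<^esub> y \<in> L" by simp_all
  show "\<lbrakk>a \<in> carrier R; x \<in> L\<rbrakk> \<Longrightarrow> a \<otimes>\<^bsub>R\<^esub> x \<in> L" by (rule I_l_closed)
qed

lemma (in ring) exists_maximal_left_ideal:
  assumes L: "left_ideal L R" and "\<one> \<notin> L"
  shows "\<exists>M. maximal_left_ideal M R \<and> L \<subseteq> M \<and> \<one> \<notin> M"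
proof -
  define S where "S = {M. left_ideal M R \<and> L \<subseteq> M \<and> \<one> \<notin> M}"
  have "L \<in> S" using assms by (simp add: S_def)
  moreover have "\<Union>C \<in> S" if C: "C \<noteq> {}" "subset.chain S C" for C
  proof -
    have CS: "M \<in> S" if "M \<in> C" for M using C(2) that by (auto simp: subset.chain_def)
    then have CL: "left_ideal M R" if "M \<in> C" for M using that by (auto simp: S_def)
    note D = left_idealD[OF CL]
    have "left_ideal (\<Union>C) R"
    proof (rule left_idealI)
      show "\<Union>C \<subseteq> carrier R" using D(1) by blast
      show "\<Union>C \<noteq> {}" using C(1) D(2) by blast
      show "x \<oplus> y \<in> \<Union>C" if xy: "x \<in> \<Union>C" "y \<in> \<Union>C" for x y
      proof -
        obtain M N where MN: "M \<in> C" "N \<in> C" "x \<in> M" "y \<in> N" using xy by blast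
        then have "M \<subseteq> N \<or> N \<subseteq> M" using C(2) by (auto simp: subset.chain_def)
        then show ?thesis using MN D(3) by blast
      qed
      show "a \<otimes> x \<in> \<Union>C" if "a \<in> carrier R" "x \<in> \<Union>C" for a x
        using that D(4) by blast
    qed
    then show ?thesis using CS C(1) unfolding S_def by blast
  qed
  ultimately obtain M where M: "M \<in> S" "\<And>N. \<lbrakk>N \<in> S; M \<subseteq> N\<rbrakk> \<Longrightarrow> N = M"
    using subset_Zorn_nonempty[of S] by blast
  have "maximal_left_ideal M R"
    unfolding maximal_left_ideal_def
  proof (intro conjI allI impI)
    show "left_ideal M R" "M \<noteq> carrier R" using M(1) by (auto simp: S_def)
    fix N assume N: "left_ideal N R \<and> M \<subseteq> N"
    note D = left_idealD[OF conjunct1[OF N]]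
    show "N = M \<or> N = carrier R"
    proof (cases "\<one> \<in> N")
      case True
      have "x \<in> N" if "x \<in> carrier R" for x using D(4)[OF that True] that by simp
      then show ?thesis using D(1) by blast
    next
      case False
      then show ?thesis using N M unfolding S_def by blast
    qed
  qed
  then show ?thesis using M(1) by (auto simp: S_def)
qed

section \<open>Graded ideals of a noetherian Rees ring\<close>

context algebra_filtration
begin

lemma submodule_\<Gamma>: "submodule K (\<Gamma> i) A"
  using subspace by (rule is_module)

lemma \<Gamma>_carrier: "x \<in> \<Gamma> i \<Longrightarrow> x \<in> carrier A"
  using submoduleD(1)[OF submodule_\<Gamma>] by blast

lemma \<Gamma>_mono: "i \<le> j \<Longrightarrow> \<Gamma> i \<subseteq> \<Gamma> j"
proof (induction rule: int_ge_induct)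
  case (step j)
  then show ?case using ascending[of j] by blast
qed simp

text \<open>The homogeneous components of a graded left ideal of the Rees ring, or of a graded right
  ideal if \<open>act\<close> is multiplication from the right, inside the ambient algebra.\<close>

definition graded_stable :: "('a \<Rightarrow> 'a \<Rightarrow> 'a) \<Rightarrow> (int \<Rightarrow> 'a set) \<Rightarrow> bool"
  where "graded_stable act L \<longleftrightarrow>
    (\<forall>n. submodule K (L n) A \<and> L n \<subseteq> \<Gamma> n) \<and>
    (\<forall>i j. \<forall>a\<in>\<Gamma> i. \<forall>x\<in>L j. act a x \<in> L (i + j))"

definition graded_acc :: "('a \<Rightarrow> 'a \<Rightarrow> 'a) \<Rightarrow> bool"
  where "graded_acc act \<longleftrightarrow> (\<forall>L :: nat \<Rightarrow> int \<Rightarrow> 'a set.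
    (\<forall>c. graded_stable act (L c)) \<longrightarrow> (\<forall>c n. L c n \<subseteq> L (Suc c) n) \<longrightarrow>
    (\<exists>c. \<forall>d n. L d n \<subseteq> L c n))"

lemma graded_stableI:
  assumes "\<And>n. submodule K (L n) A" "\<And>n. L n \<subseteq> \<Gamma> n"
    and "\<And>i j a x. \<lbrakk>a \<in> \<Gamma> i; x \<in> L j\<rbrakk> \<Longrightarrow> act a x \<in> L (i + j)"
  shows "graded_stable act L"
  using assms by (auto simp: graded_stable_def)

lemma graded_stableD:
  assumes "graded_stable act L"
  shows "submodule K (L n) A" and "L n \<subseteq> \<Gamma> n"
    and "\<lbrakk>a \<in> \<Gamma> i; x \<in> L j\<rbrakk> \<Longrightarrow> act a x \<in> L (i + j)"
  using assms by (auto simp: graded_stable_def)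

lemma rees_ring_simps:
  "carrier (rees_ring A \<Gamma>) = {f. (\<forall>i. f i \<in> \<Gamma> i) \<and> finite {i. f i \<noteq> \<zero>\<^bsub>A\<^esub>}}"
  "zero (rees_ring A \<Gamma>) = (\<lambda>n. \<zero>\<^bsub>A\<^esub>)"
  "add (rees_ring A \<Gamma>) = (\<lambda>f g n. f n \<oplus>\<^bsub>A\<^esub> g n)"
  "mult (rees_ring A \<Gamma>) = (\<lambda>f g n. \<Oplus>\<^bsub>A\<^esub>i\<in>{i. f i \<noteq> \<zero>\<^bsub>A\<^esub>}. f i \<otimes>\<^bsub>A\<^esub> g (n - i))"
  by (simp_all add: rees_ring_def)

text \<open>The graded ideal of the Rees ring with the homogeneous components \<open>L\<close>.\<close>

definition homogeneous_part :: "(int \<Rightarrow> 'a set) \<Rightarrow> (int \<Rightarrow> 'a) set"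
  where "homogeneous_part L = {f \<in> carrier (rees_ring A \<Gamma>). \<forall>i. f i \<in> L i}"

lemma left_ideal_homogeneous_part:
  assumes Q: "ring Q" and car: "carrier Q = carrier (rees_ring A \<Gamma>)"
    and add: "add Q = add (rees_ring A \<Gamma>)" and zero: "zero Q = zero (rees_ring A \<Gamma>)"
    and mult: "\<And>f g n. \<lbrakk>f \<in> carrier Q; g \<in> homogeneous_part L\<rbrakk> \<Longrightarrow> (f \<otimes>\<^bsub>Q\<^esub> g) n \<in> L n"
    and L: "graded_stable act L"
  shows "left_ideal (homogeneous_part L) Q"
proof -
  interpret Q: ring Q by (rule Q)
  note sub = submoduleD[OF graded_stableD(1)[OF L]]
  show ?thesis
  proof (rule Q.left_idealI)
    show "homogeneous_part L \<subseteq> carrier Q" by (auto simp: homogeneous_part_def car)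
    have "\<zero>\<^bsub>Q\<^esub> \<in> homogeneous_part L"
      using Q.zero_closed sub(2) by (auto simp: homogeneous_part_def car zero rees_ring_simps(2))
    then show "homogeneous_part L \<noteq> {}" by blast
    show "f \<oplus>\<^bsub>Q\<^esub> g \<in> homogeneous_part L" if "f \<in> homogeneous_part L" "g \<in> homogeneous_part L" for f g
    proof -
      have "f \<oplus>\<^bsub>Q\<^esub> g \<in> carrier Q"
        by (rule Q.a_closed) (use that car in \<open>auto simp: homogeneous_part_def\<close>)
      then show ?thesis
        using that sub(3) by (auto simp: homogeneous_part_def car add rees_ring_simps(3))
    qed
    show "x \<otimes>\<^bsub>Q\<^esub> f \<in> homogeneous_part L" if "x \<in> carrier Q" "f \<in> homogeneous_part L" for x f
    proof -
      have "f \<in> carrier Q" using that car by (simp add: homogeneous_part_def)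
      then have "x \<otimes>\<^bsub>Q\<^esub> f \<in> carrier Q" using that by simp
      then show ?thesis using mult[OF that] by (simp add: homogeneous_part_def car)
    qed
  qed
qed

text \<open>Finite generation of the union of an ascending chain of ideals makes the chain stationary.
  The ring \<open>Q\<close> is the Rees ring or its opposite; the multiplication enters only through the fact that
  graded stable families give ideals.\<close>

lemma noetherian_graded_acc:
  assumes Q: "left_noetherian_ring Q" and car: "carrier Q = carrier (rees_ring A \<Gamma>)"
    and add: "add Q = add (rees_ring A \<Gamma>)" and zero: "zero Q = zero (rees_ring A \<Gamma>)"
    and mult: "\<And>L f g n. \<lbrakk>graded_stable act L; f \<in> carrier Q; g \<in> homogeneous_part L\<rbrakk> \<Longrightarrow>
      (f \<otimes>\<^bsub>Q\<^esub> g) n \<in> L n"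
  shows "graded_acc act"
  unfolding graded_acc_def
proof (intro allI impI)
  fix L :: "nat \<Rightarrow> int \<Rightarrow> 'a set"
  assume L: "\<forall>c. graded_stable act (L c)" and asc: "\<forall>c n. L c n \<subseteq> L (Suc c) n"
  interpret Q: left_noetherian_ring Q by (rule Q)
  define H where "H c = homogeneous_part (L c)" for c
  have asc': "L c n \<subseteq> L d n" if "c \<le> d" for c d n
    using that by (induction rule: dec_induct) (use asc in blast)+
  have H_mono: "H c \<subseteq> H d" if "c \<le> d" for c d
    using asc'[OF that] by (auto simp: H_def homogeneous_part_def)
  have H: "left_ideal (H c) Q" for c
    unfolding H_def
    by (rule left_ideal_homogeneous_part[OF Q.ring_axioms car add zero _ L[rule_format]])
      (rule mult[OF L[rule_format]])
  have common: "\<exists>c. f \<in> H c \<and> g \<in> H c" if "f \<in> (\<Union>c. H c)" "g \<in> (\<Union>c. H c)" for f g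
  proof -
    obtain c d where "f \<in> H c" "g \<in> H d" using \<open>f \<in> _\<close> \<open>g \<in> _\<close> by blast
    then show ?thesis using H_mono[of c "max c d"] H_mono[of d "max c d"] by auto
  qed
  note HD = left_idealD[OF H]
  have "left_ideal (\<Union>c. H c) Q"
  proof (rule Q.left_idealI)
    fix f g assume "f \<in> (\<Union>c. H c)" "g \<in> (\<Union>c. H c)"
    then obtain c where "f \<in> H c" "g \<in> H c" using common by blast
    then show "f \<oplus>\<^bsub>Q\<^esub> g \<in> (\<Union>c. H c)" using HD(3) by blast
  next
    show "(\<Union>c. H c) \<subseteq> carrier Q" using HD(1) by (rule UN_least)
    show "(\<Union>c. H c) \<noteq> {}" using HD(2)[of 0] by auto
    show "x \<otimes>\<^bsub>Q\<^esub> f \<in> (\<Union>c. H c)" if x: "x \<in> carrier Q" and f: "f \<in> (\<Union>c. H c)" for x f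
    proof -
      obtain c where "f \<in> H c" using f by (rule UN_E)
      then show ?thesis using HD(4)[OF x] by (intro UN_I[of c]) auto
    qed
  qed
  from Q.finitely_gen[OF this]
  obtain S where "S \<subseteq> carrier Q \<and> finite S \<and> (\<Union>c. H c) = gen_left_ideal Q S"
    by (rule exE)
  then have S: "finite S" "(\<Union>c. H c) = gen_left_ideal Q S" by auto
  have "S \<subseteq> (\<Union>c. H c)" unfolding S(2) gen_left_ideal_def by blast
  with S(1) have "\<exists>c. S \<subseteq> H c"
  proof (induction S rule: finite_induct)
    case (insert f S)
    then obtain c d where "S \<subseteq> H c" "f \<in> H d" by auto
    then have "insert f S \<subseteq> H (max c d)" using H_mono[of c "max c d"] H_mono[of d "max c d"] by auto
    then show ?case by blast
  qed simp
  then obtain c where c: "S \<subseteq> H c" by blast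
  have UH: "(\<Union>c. H c) \<subseteq> H c" unfolding S(2) gen_left_ideal_def using H c by blast
  have "L d n \<subseteq> L c n" for d n
  proof
    fix x assume x: "x \<in> L d n"
    have "x \<in> \<Gamma> n" using graded_stableD(2) L x by blast
    then have "(\<lambda>i. if i = n then x else \<zero>\<^bsub>A\<^esub>) \<in> H d"
      using x submoduleD(2)[OF submodule_\<Gamma>] submoduleD(2)[OF graded_stableD(1)[OF L[rule_format]]]
      by (auto simp: H_def homogeneous_part_def rees_ring_simps intro: finite_subset[of _ "{n}"])
    then have "(\<lambda>i. if i = n then x else \<zero>\<^bsub>A\<^esub>) \<in> H c" using UH by blast
    then have "\<forall>i. (if i = n then x else \<zero>\<^bsub>A\<^esub>) \<in> L c i" by (simp add: H_def homogeneous_part_def)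
    then show "x \<in> L c n" by (metis (full_types))
  qed
  then show "\<exists>c. \<forall>d n. L d n \<subseteq> L c n" by blast
qed

lemma finsum_in_submodule:
  assumes U: "submodule K U A" and "\<And>i. i \<in> S \<Longrightarrow> f i \<in> U"
  shows "(\<Oplus>\<^bsub>A\<^esub>i\<in>S. f i) \<in> U"
  using assms(2)
proof (induction S rule: infinite_finite_induct)
  case (insert i S)
  have "finsum A f (insert i S) = f i \<oplus>\<^bsub>A\<^esub> finsum A f S"
    using insert submoduleD(1)[OF U] by (intro module.M.finsum_insert) auto
  then show ?case using insert submoduleD(3)[OF U] by auto
qed (use submoduleD(2)[OF U] in simp_all)

lemma left_noetherian_graded_acc:
  assumes "left_noetherian_ring (rees_ring A \<Gamma>)"
  shows "graded_acc (\<lambda>a x. a \<otimes>\<^bsub>A\<^esub> x)"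
proof (rule noetherian_graded_acc[OF assms])
  fix L f g n
  assume L: "graded_stable (\<lambda>a x. a \<otimes>\<^bsub>A\<^esub> x) L" and f: "f \<in> carrier (rees_ring A \<Gamma>)"
    and g: "g \<in> homogeneous_part L"
  have "f i \<otimes>\<^bsub>A\<^esub> g (n - i) \<in> L n" for i
    using graded_stableD(3)[OF L, of "f i" i "g (n - i)" "n - i"] f g
    by (auto simp: rees_ring_simps homogeneous_part_def)
  then show "(f \<otimes>\<^bsub>rees_ring A \<Gamma>\<^esub> g) n \<in> L n"
    unfolding rees_ring_simps by (intro finsum_in_submodule graded_stableD(1)[OF L])
qed auto

lemma right_noetherian_graded_acc:
  assumes "left_noetherian_ring (opp_ring (rees_ring A \<Gamma>))"
  shows "graded_acc (\<lambda>a x. x \<otimes>\<^bsub>A\<^esub> a)"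
proof (rule noetherian_graded_acc[OF assms])
  fix L f g n
  assume L: "graded_stable (\<lambda>a x. x \<otimes>\<^bsub>A\<^esub> a) L" and f: "f \<in> carrier (opp_ring (rees_ring A \<Gamma>))"
    and g: "g \<in> homogeneous_part L"
  have "g i \<otimes>\<^bsub>A\<^esub> f (n - i) \<in> L n" for i
    using graded_stableD(3)[OF L, of "f (n - i)" "n - i" "g i" i] f g
    by (auto simp: rees_ring_simps homogeneous_part_def opp_ring_def)
  then have "(g \<otimes>\<^bsub>rees_ring A \<Gamma>\<^esub> f) n \<in> L n"
    unfolding rees_ring_simps by (intro finsum_in_submodule graded_stableD(1)[OF L])
  then show "(f \<otimes>\<^bsub>opp_ring (rees_ring A \<Gamma>)\<^esub> g) n \<in> L n"
    by (simp add: opp_ring_def)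
qed (auto simp: opp_ring_def)

end

section \<open>Subexponential growth\<close>

context algebra_filtration
begin

definition jump :: "int \<Rightarrow> nat"
  where "jump i = rank_over (\<Gamma> (i - 1)) (\<Gamma> i)"

lemma generated_over_jump: "generated_over (jump i) (\<Gamma> (i - 1)) (\<Gamma> i)"
  unfolding jump_def
  using fin_dim_quotient_generated_over[OF submodule_\<Gamma> submodule_\<Gamma> \<Gamma>_mono finite_steps, of i]
    generated_over_rank by auto

lemma right_mult_hom: "b \<in> carrier A \<Longrightarrow> (\<lambda>x. x \<otimes>\<^bsub>A\<^esub> b) \<in> module_hom K A A"
  by (auto simp: module_hom_def A.l_distr smult_mult_left)

lemma left_mult_hom: "b \<in> carrier A \<Longrightarrow> (\<lambda>x. b \<otimes>\<^bsub>A\<^esub> x) \<in> module_hom K A A"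
  by (auto simp: module_hom_def A.r_distr smult_mult_right)

text \<open>If the sums on the left were all smaller, then elements \<open>x\<^sub>k\<close> of \<open>\<Gamma>\<close> in degree
  \<open>d k\<close> could be chosen recursively outside \<open>\<Gamma>\<^bsub>d k - 1\<^esub> + \<Sum>\<^bsub>i<k\<^esub> \<Gamma>\<^bsub>d k - d i\<^esub> x\<^sub>i\<close>, since the \<open>i\<close>-th
  summand contributes at most \<open>jump (d k - d i)\<close> to the dimension modulo \<open>\<Gamma>\<^bsub>d k - 1\<^esub>\<close>. The
  graded left ideals generated by \<open>x\<^sub>0, \<dots>, x\<^sub>k\<^sub>-\<^sub>1\<close> would then ascend strictly. The recursion is carried
  out on these ideals rather than on the elements.\<close>

lemma no_lacunary_jumps:
  fixes d :: "nat \<Rightarrow> int"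
  assumes acc: "graded_acc (\<lambda>a x. a \<otimes>\<^bsub>A\<^esub> x)"
  shows "\<not> (\<forall>k. (\<Sum>i<k. jump (d k - d i)) < jump (d k))"
proof
  assume big: "\<forall>k. (\<Sum>i<k. jump (d k - d i)) < jump (d k)"
  define P where "P k L \<longleftrightarrow> graded_stable (\<lambda>a x. a \<otimes>\<^bsub>A\<^esub> x) L \<and>
    (\<forall>n. generated_over (\<Sum>i<k. jump (n - d i)) (\<Gamma> (n - 1)) (\<Gamma> (n - 1) <+>\<^bsub>A\<^esub> L n))" for k L
  have "\<exists>L. \<forall>k. P k (L k) \<and> ((\<forall>n. L k n \<subseteq> L (Suc k) n) \<and> \<not> L (Suc k) (d k) \<subseteq> L k (d k))"
  proof (rule dependent_nat_choice)
    have zero: "submodule K {\<zero>\<^bsub>A\<^esub>} A" by (rule submoduleI) auto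
    have "\<Gamma> n <+>\<^bsub>A\<^esub> {\<zero>\<^bsub>A\<^esub>} = \<Gamma> n" for n
      using set_add_upper(1)[OF submodule_\<Gamma> zero] submoduleD(2)[OF submodule_\<Gamma>]
      by (intro equalityI set_add_least[OF submodule_\<Gamma>]) auto
    then have "P 0 (\<lambda>n. {\<zero>\<^bsub>A\<^esub>})"
      unfolding P_def graded_stable_def
      using zero submoduleD(2)[OF submodule_\<Gamma>] \<Gamma>_carrier by simp
    then show "\<exists>L. P 0 L" by blast
  next
    fix L k assume "P k L"
    then have L: "graded_stable (\<lambda>a x. a \<otimes>\<^bsub>A\<^esub> x) L"
      and gen: "\<And>n. generated_over (\<Sum>i<k. jump (n - d i)) (\<Gamma> (n - 1)) (\<Gamma> (n - 1) <+>\<^bsub>A\<^esub> L n)"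
      by (auto simp: P_def)
    note LD = graded_stableD[OF L]
    have GL: "submodule K (\<Gamma> (n - 1) <+>\<^bsub>A\<^esub> L n) A" for n
      by (rule submodule_set_add[OF submodule_\<Gamma> LD(1)])
    have "\<Gamma> (d k - 1) <+>\<^bsub>A\<^esub> L (d k) \<noteq> \<Gamma> (d k)"
    proof
      assume "\<Gamma> (d k - 1) <+>\<^bsub>A\<^esub> L (d k) = \<Gamma> (d k)"
      then have "jump (d k) \<le> (\<Sum>i<k. jump (d k - d i))"
        unfolding jump_def[of "d k"] using gen[of "d k"] by (intro rank_over_le) simp
      then show False using big[rule_format, of k] by simp
    qed
    moreover have "\<Gamma> (d k - 1) <+>\<^bsub>A\<^esub> L (d k) \<subseteq> \<Gamma> (d k)"
      by (rule set_add_least[OF submodule_\<Gamma> \<Gamma>_mono LD(2)]) simp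
    ultimately obtain x where x: "x \<in> \<Gamma> (d k)" "x \<notin> \<Gamma> (d k - 1) <+>\<^bsub>A\<^esub> L (d k)" by blast
    have xc: "x \<in> carrier A" using x \<Gamma>_carrier by blast
    note hom = right_mult_hom[OF xc]
    \<comment> \<open>The multiples of \<open>x\<close> are added to \<open>L\<close>; the multiplier has degree \<open>n - d k\<close> because \<open>x\<close> has degree \<open>d k\<close>.\<close>
    let ?M = "\<lambda>n. (\<lambda>a. a \<otimes>\<^bsub>A\<^esub> x) ` \<Gamma> (n - d k)"
    define L' where "L' n = L n <+>\<^bsub>A\<^esub> ?M n" for n
    have M: "submodule K (?M n) A" for n by (rule submodule_image[OF submodule_\<Gamma> hom])
    have M\<Gamma>: "?M n \<subseteq> \<Gamma> n" for n
      using mult_mem[OF _ x(1), of _ "n - d k"] by auto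
    have L': "submodule K (L' n) A" for n unfolding L'_def by (rule submodule_set_add[OF LD(1) M])
    have stable: "graded_stable (\<lambda>a x. a \<otimes>\<^bsub>A\<^esub> x) L'"
    proof (rule graded_stableI)
      show "L' n \<subseteq> \<Gamma> n" for n
        unfolding L'_def by (rule set_add_least[OF submodule_\<Gamma> LD(2) M\<Gamma>])
      show "a \<otimes>\<^bsub>A\<^esub> y \<in> L' (i + j)" if a: "a \<in> \<Gamma> i" and y: "y \<in> L' j" for i j a y
      proof -
        obtain u b where u: "u \<in> L j" "b \<in> \<Gamma> (j - d k)" "y = u \<oplus>\<^bsub>A\<^esub> b \<otimes>\<^bsub>A\<^esub> x"
          using y unfolding L'_def by (auto elim!: set_add_memE)
        have c: "a \<in> carrier A" "b \<in> carrier A" "u \<in> carrier A"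
          using a u LD(2) \<Gamma>_carrier by blast+
        have "a \<otimes>\<^bsub>A\<^esub> y = a \<otimes>\<^bsub>A\<^esub> u \<oplus>\<^bsub>A\<^esub> (a \<otimes>\<^bsub>A\<^esub> b) \<otimes>\<^bsub>A\<^esub> x"
          using c xc u(3) by (simp add: A.r_distr A.m_assoc)
        moreover have "a \<otimes>\<^bsub>A\<^esub> u \<in> L (i + j)" using LD(3) a u(1) by blast
        moreover have "a \<otimes>\<^bsub>A\<^esub> b \<in> \<Gamma> (i + j - d k)"
          using mult_mem[OF a u(2)] by (simp add: algebra_simps)
        ultimately show ?thesis unfolding L'_def by (simp add: set_add_memI)
      qed
    qed (rule L')
    have "generated_over (\<Sum>i<Suc k. jump (n - d i)) (\<Gamma> (n - 1)) (\<Gamma> (n - 1) <+>\<^bsub>A\<^esub> L' n)" for n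
    proof -
      have "(\<lambda>a. a \<otimes>\<^bsub>A\<^esub> x) ` \<Gamma> (n - d k - 1) \<subseteq> \<Gamma> (n - 1)"
        using mult_mem[OF _ x(1), of _ "n - d k - 1"] by (auto simp: algebra_simps)
      then have "generated_over (jump (n - d k)) (\<Gamma> (n - 1) <+>\<^bsub>A\<^esub> L n)
          ((\<Gamma> (n - 1) <+>\<^bsub>A\<^esub> L n) <+>\<^bsub>A\<^esub> ?M n)"
        using set_add_upper(1)[OF submodule_\<Gamma> LD(1), of "n - 1" n]
        by (intro generated_over_image[OF submodule_\<Gamma> submodule_\<Gamma> GL hom generated_over_jump]) auto
      moreover have "(\<Gamma> (n - 1) <+>\<^bsub>A\<^esub> L n) <+>\<^bsub>A\<^esub> ?M n = \<Gamma> (n - 1) <+>\<^bsub>A\<^esub> L' n"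
      proof
        note up = set_add_upper[OF submodule_\<Gamma> LD(1)] set_add_upper[OF GL M]
          set_add_upper[OF LD(1) M] set_add_upper[OF submodule_\<Gamma> L']
        show "(\<Gamma> (n - 1) <+>\<^bsub>A\<^esub> L n) <+>\<^bsub>A\<^esub> ?M n \<subseteq> \<Gamma> (n - 1) <+>\<^bsub>A\<^esub> L' n"
          unfolding L'_def[symmetric]
          by (intro set_add_least submodule_set_add[OF submodule_\<Gamma> L'] up(7)
              order_trans[OF _ up(8)]) (unfold L'_def, rule up(5), rule up(6))
        show "\<Gamma> (n - 1) <+>\<^bsub>A\<^esub> L' n \<subseteq> (\<Gamma> (n - 1) <+>\<^bsub>A\<^esub> L n) <+>\<^bsub>A\<^esub> ?M n"
          unfolding L'_def
          by (intro set_add_least submodule_set_add[OF GL M] up(4) order_trans[OF _ up(3)] up(1,2))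
      qed
      ultimately show ?thesis
        using generated_over_trans[OF submodule_\<Gamma> GL submodule_set_add[OF submodule_\<Gamma> L'] _ gen[of n],
            of "n - 1" n "jump (n - d k)"]
          set_add_upper(1)[OF GL M, of n n] by simp
    qed
    with stable have "P (Suc k) L'" by (simp add: P_def)
    moreover have "L n \<subseteq> L' n" for n unfolding L'_def by (rule set_add_upper(1)[OF LD(1) M])
    moreover have "\<not> L' (d k) \<subseteq> L (d k)"
    proof
      assume "L' (d k) \<subseteq> L (d k)"
      moreover have "x \<in> ?M (d k)"
        by (rule image_eqI[of _ _ "\<one>\<^bsub>A\<^esub>"]) (use one_mem xc in auto)
      then have "x \<in> L' (d k)"
        unfolding L'_def by (rule subsetD[OF set_add_upper(2)[OF LD(1) M]])
      ultimately have "x \<in> L (d k)" by blast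
      then show False using x(2) set_add_upper(2)[OF submodule_\<Gamma> LD(1)] by blast
    qed
    ultimately show "\<exists>L'. P (Suc k) L' \<and> ((\<forall>n. L n \<subseteq> L' n) \<and> \<not> L' (d k) \<subseteq> L (d k))" by blast
  qed
  then obtain L where L: "\<And>k. P k (L k)" "\<And>k n. L k n \<subseteq> L (Suc k) n"
    "\<And>k. \<not> L (Suc k) (d k) \<subseteq> L k (d k)" by blast
  then obtain c where "\<And>k n. L k n \<subseteq> L c n"
    using acc unfolding graded_acc_def P_def by meson
  then show False using L(3)[of c] by blast
qed

text \<open>The previous lemma applies to increasing and to decreasing degrees, so the growth is
  subexponential in both directions.\<close>

lemma subexponential_jumps:
  fixes r :: real
  assumes acc: "graded_acc (\<lambda>a x. a \<otimes>\<^bsub>A\<^esub> x)" and r: "r > 1"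
  shows "\<exists>C. \<forall>i. real (jump i) \<le> C * r ^ nat \<bar>i\<bar>"
proof -
  have "\<exists>C. \<forall>n::nat. real (jump (\<epsilon> * int n)) \<le> C * r ^ n" for \<epsilon> :: int
  proof (rule ccontr)
    assume "\<not> (\<exists>C. \<forall>n::nat. real (jump (\<epsilon> * int n)) \<le> C * r ^ n)"
    then have "\<And>C. \<exists>n::nat. real (jump (\<epsilon> * int n)) > C * r ^ n" by (meson not_le)
    then obtain d :: "nat \<Rightarrow> nat" where d: "\<And>i k. i < k \<Longrightarrow> d i < d k"
      "\<And>k. (\<Sum>i<k. jump (\<epsilon> * int (d k - d i))) < jump (\<epsilon> * int (d k))"
      using lacunary_sequence[OF r, of "\<lambda>n. jump (\<epsilon> * int n)"] by blast
    have "(\<Sum>i<k. jump (\<epsilon> * int (d k) - \<epsilon> * int (d i))) = (\<Sum>i<k. jump (\<epsilon> * int (d k - d i)))" for k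
      by (rule sum.cong) (use d(1) in \<open>auto simp: of_nat_diff less_imp_le right_diff_distrib\<close>)
    then show False using d(2) no_lacunary_jumps[OF acc, of "\<lambda>k. \<epsilon> * int (d k)"] by simp
  qed
  from this[of 1] this[of "-1"] obtain C D where
    C: "\<And>n::nat. real (jump (int n)) \<le> C * r ^ n" and D: "\<And>n::nat. real (jump (- int n)) \<le> D * r ^ n"
    by auto
  have "real (jump i) \<le> max C D * r ^ nat \<bar>i\<bar>" for i
  proof -
    have "real (jump i) \<le> (if i \<ge> 0 then C else D) * r ^ nat \<bar>i\<bar>"
      using C[of "nat i"] D[of "nat (- i)"] by auto
    also have "\<dots> \<le> max C D * r ^ nat \<bar>i\<bar>" using r by (intro mult_right_mono) auto
    finally show ?thesis .
  qed
  then show ?thesis by blast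
qed

end

section \<open>The Jacobson radical\<close>

context algebra_filtration
begin

lemma ring_\<Gamma>_0: "ring (A\<lparr>carrier := \<Gamma> 0\<rparr>)"
proof -
  interpret \<Gamma>: module K "A\<lparr>carrier := \<Gamma> 0\<rparr>" by (rule submodule_is_module[OF submodule_\<Gamma>])
  show ?thesis
  proof (rule ringI)
    show "abelian_group (A\<lparr>carrier := \<Gamma> 0\<rparr>)" by unfold_locales
    show "Group.monoid (A\<lparr>carrier := \<Gamma> 0\<rparr>)"
      by (rule Group.monoidI) (use mult_mem[of _ 0 _ 0] one_mem \<Gamma>_carrier A.m_assoc in auto)
  qed (use \<Gamma>_carrier in \<open>auto simp: A.l_distr A.r_distr\<close>)
qed

text \<open>With \<open>1 = u + a\<close>, a maximal left ideal of \<open>\<Gamma>\<^sub>0\<close> that contains \<open>I \<inter> \<Gamma>\<^sub>0\<close>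
  contains \<open>a\<close>, and it contains \<open>u\<close> because \<open>u\<close> lies in the Jacobson radical.\<close>

lemma one_in_ideal_by_jacobson:
  assumes I: "ideal I A" and J: "\<Gamma> (- 1) \<subseteq> jacobson_radical (A\<lparr>carrier := \<Gamma> 0\<rparr>)"
    and one: "\<one>\<^bsub>A\<^esub> \<in> \<Gamma> (- 1) <+>\<^bsub>A\<^esub> I"
  shows "\<one>\<^bsub>A\<^esub> \<in> I"
proof (rule ccontr)
  assume no: "\<one>\<^bsub>A\<^esub> \<notin> I"
  let ?B = "A\<lparr>carrier := \<Gamma> 0\<rparr>"
  interpret B: ring ?B by (rule ring_\<Gamma>_0)
  interpret I: ideal I A by (rule I)
  note \<Gamma>D = submoduleD[OF submodule_\<Gamma>]
  have zero: "\<zero>\<^bsub>A\<^esub> \<in> I \<inter> \<Gamma> 0" using \<Gamma>D(2) by simp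
  have "left_ideal (I \<inter> \<Gamma> 0) ?B"
  proof (rule B.left_idealI)
    show "I \<inter> \<Gamma> 0 \<noteq> {}" using zero by blast
  qed (use \<Gamma>D(3) \<Gamma>_carrier I.I_l_closed mult_mem[of _ 0 _ 0] in auto)
  then obtain M where M: "maximal_left_ideal M ?B" "I \<inter> \<Gamma> 0 \<subseteq> M" "\<one>\<^bsub>A\<^esub> \<notin> M"
    using B.exists_maximal_left_ideal[of "I \<inter> \<Gamma> 0"] no by auto
  obtain u a where ua: "u \<in> \<Gamma> (- 1)" "a \<in> I" "\<one>\<^bsub>A\<^esub> = u \<oplus>\<^bsub>A\<^esub> a" using one by (rule set_add_memE)
  have u: "u \<in> M" "u \<in> \<Gamma> 0" using J ua(1) M(1) by (auto simp: jacobson_radical_def)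
  have "\<ominus>\<^bsub>A\<^esub> u \<oplus>\<^bsub>A\<^esub> \<one>\<^bsub>A\<^esub> \<in> \<Gamma> 0" using \<Gamma>D(3,5) u(2) one_mem by blast
  then have "a \<in> \<Gamma> 0" using ua \<Gamma>_carrier[OF u(2)] by (simp add: module.M.r_neg1)
  then have "a \<in> M" using ua M(2) by blast
  have "left_ideal M ?B" using M(1) by (simp add: maximal_left_ideal_def)
  from left_idealD(3)[OF this u(1) \<open>a \<in> M\<close>] show False using ua(3) M(3) by simp
qed

end

section \<open>Filtrations induced on quotients and on free modules\<close>

lemma (in assoc_algebra) submodule_ideal:
  assumes "ideal J A"
  shows "submodule K J A"
proof -
  interpret J: ideal J A by (rule assms)
  show ?thesis
  proof (rule submoduleI)
    show "c \<odot>\<^bsub>A\<^esub> x \<in> J" if "c \<in> carrier K" "x \<in> J" for c x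
    proof -
      have "(c \<odot>\<^bsub>A\<^esub> \<one>\<^bsub>A\<^esub>) \<otimes>\<^bsub>A\<^esub> x = c \<odot>\<^bsub>A\<^esub> x" using that by (simp add: smult_mult_left)
      moreover have "(c \<odot>\<^bsub>A\<^esub> \<one>\<^bsub>A\<^esub>) \<otimes>\<^bsub>A\<^esub> x \<in> J" using that by (intro J.I_l_closed) auto
      ultimately show ?thesis by simp
    qed
  qed (use J.a_subset in auto)
qed

context algebra_filtration
begin

text \<open>The filtration induced on the quotient by \<open>I\<close>, given by full preimages in the algebra.\<close>

definition coset_filtration :: "'a set \<Rightarrow> int \<Rightarrow> 'a set"
  where "coset_filtration I i = \<Gamma> i <+>\<^bsub>A\<^esub> I"

lemma submodule_coset_filtration: "submodule K I A \<Longrightarrow> submodule K (coset_filtration I i) A"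
  unfolding coset_filtration_def by (intro submodule_set_add submodule_\<Gamma>)

lemma coset_filtration_mono: "i \<le> j \<Longrightarrow> coset_filtration I i \<subseteq> coset_filtration I j"
  unfolding coset_filtration_def by (intro set_add_mono \<Gamma>_mono order_refl)

lemma generated_over_coset_filtration:
  assumes I: "submodule K I A" and "m \<le> n"
  shows "generated_over (\<Sum>i\<in>{m<..n}. jump i) (coset_filtration I m) (coset_filtration I n)"
  using assms(2)
proof (induction rule: int_ge_induct)
  case base
  then show ?case by simp
next
  case (step n)
  note F = submodule_coset_filtration[OF I]
  have "generated_over (jump (n + 1)) (coset_filtration I n)
      (coset_filtration I n <+>\<^bsub>A\<^esub> (\<lambda>x. x) ` \<Gamma> (n + 1))"
    using generated_over_jump[of "n + 1"] set_add_upper(1)[OF submodule_\<Gamma> I, of n]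
    by (intro generated_over_image[OF submodule_\<Gamma> submodule_\<Gamma> F id_module_hom])
      (auto simp: coset_filtration_def)
  also have "coset_filtration I n <+>\<^bsub>A\<^esub> (\<lambda>x. x) ` \<Gamma> (n + 1) = coset_filtration I (n + 1)"
  proof
    show "coset_filtration I n <+>\<^bsub>A\<^esub> (\<lambda>x. x) ` \<Gamma> (n + 1) \<subseteq> coset_filtration I (n + 1)"
      using coset_filtration_mono[of n "n + 1" I] set_add_upper(1)[OF submodule_\<Gamma> I, of "n + 1"]
      by (intro set_add_least[OF F]) (auto simp: coset_filtration_def)
    have "I \<subseteq> coset_filtration I n" unfolding coset_filtration_def
      by (rule set_add_upper(2)[OF submodule_\<Gamma> I])
    then show "coset_filtration I (n + 1) \<subseteq> coset_filtration I n <+>\<^bsub>A\<^esub> (\<lambda>x. x) ` \<Gamma> (n + 1)"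
      using set_add_upper[OF F[of n] submodule_\<Gamma>[of "n + 1"]]
      unfolding coset_filtration_def[of I "n + 1"]
      by (intro set_add_least submodule_set_add[OF F]) (auto simp: submodule_\<Gamma>)
  qed
  finally have *: "generated_over (jump (n + 1)) (coset_filtration I n) (coset_filtration I (n + 1))" .
  have "{m<..n + 1} = insert (n + 1) {m<..n}" using step(1) by auto
  then have "(\<Sum>i\<in>{m<..n + 1}. jump i) = (\<Sum>i\<in>{m<..n}. jump i) + jump (n + 1)" by simp
  then show ?case
    using generated_over_trans[OF F F F coset_filtration_mono step.IH *] by simp
qed

lemma sum_images_exhaust:
  assumes J: "submodule K J A" and hom: "\<And>k. k < t \<Longrightarrow> \<phi> k \<in> module_hom K A A"
    and "x \<in> sum_images J \<phi> (carrier A) t"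
  shows "\<exists>m. x \<in> sum_images J \<phi> (\<Gamma> m) t"
  using assms(2,3)
proof (induction t arbitrary: x)
  case (Suc t)
  obtain y z where x: "y \<in> sum_images J \<phi> (carrier A) t" "z \<in> carrier A" "x = y \<oplus>\<^bsub>A\<^esub> \<phi> t z"
    using Suc.prems(2) by (auto elim!: set_add_memE)
  obtain m where m: "y \<in> sum_images J \<phi> (\<Gamma> m) t" using Suc x(1) by (metis less_Suc_eq)
  obtain n where n: "z \<in> \<Gamma> n" using x(2) exhaustive by auto
  have "y \<in> sum_images J \<phi> (\<Gamma> (max m n)) t"
    using m by (rule subsetD[OF sum_images_mono[OF \<Gamma>_mono], rotated]) simp
  moreover have "z \<in> \<Gamma> (max m n)"
    using n by (rule subsetD[OF \<Gamma>_mono, rotated]) simp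
  ultimately have "x \<in> sum_images J \<phi> (\<Gamma> (max m n)) (Suc t)" using x(3) by (simp add: set_add_memI)
  then show ?case by blast
qed simp

text \<open>A filtration with noetherian Rees ring induces a good filtration on a finitely generated
  subquotient \<open>M/J\<close>: up to a shift \<open>c\<close>, it is bounded by the filtration that comes from the
  generators. The elements of \<open>M \<inter> \<Gamma>\<^sub>n\<close> that need a shift of at most \<open>c\<close> form a graded ideal, these
  ideals ascend with \<open>c\<close>, and every element of \<open>M\<close> needs some finite shift.\<close>

lemma good_filtration:
  assumes acc: "graded_acc act"
    and J: "submodule K J A" and M: "submodule K M A"
    and hom: "\<And>k. k < t \<Longrightarrow> \<phi> k \<in> module_hom K A A"
    and gen: "M \<subseteq> sum_images J \<phi> (carrier A) t"
    and act_add: "\<And>a x y. \<lbrakk>a \<in> carrier A; x \<in> carrier A; y \<in> carrier A\<rbrakk> \<Longrightarrow>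
      act a (x \<oplus>\<^bsub>A\<^esub> y) = act a x \<oplus>\<^bsub>A\<^esub> act a y"
    and act_\<Gamma>: "\<And>a x i j. \<lbrakk>a \<in> \<Gamma> i; x \<in> \<Gamma> j\<rbrakk> \<Longrightarrow> act a x \<in> \<Gamma> (i + j)"
    and act_J: "\<And>a x. \<lbrakk>a \<in> carrier A; x \<in> J\<rbrakk> \<Longrightarrow> act a x \<in> J"
    and act_M: "\<And>a x. \<lbrakk>a \<in> carrier A; x \<in> M\<rbrakk> \<Longrightarrow> act a x \<in> M"
    and act_hom: "\<And>a x k. \<lbrakk>k < t; a \<in> carrier A; x \<in> carrier A\<rbrakk> \<Longrightarrow> act a (\<phi> k x) = \<phi> k (act a x)"
  shows "\<exists>c::nat. \<forall>n. M \<inter> \<Gamma> n \<subseteq> sum_images J \<phi> (\<Gamma> (n + int c)) t"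
proof -
  \<comment> \<open>The part of \<open>M\<close> that needs a shift of at most \<open>c\<close>.\<close>
  define L where "L c n = (M \<inter> \<Gamma> n) \<inter> sum_images J \<phi> (\<Gamma> (n + int c)) t" for c n
  have S: "submodule K (sum_images J \<phi> (\<Gamma> m) k) A" if "k \<le> t" for m k
    by (rule submodule_sum_images[OF J submodule_\<Gamma>]) (use hom that in auto)
  have act_S: "act a x \<in> sum_images J \<phi> (\<Gamma> (i + m)) k"
    if "k \<le> t" "a \<in> \<Gamma> i" "x \<in> sum_images J \<phi> (\<Gamma> m) k" for k a x i m
    using that
  proof (induction k arbitrary: x)
    case 0
    then show ?case using act_J \<Gamma>_carrier by auto
  next
    case (Suc k)
    obtain y z where x: "y \<in> sum_images J \<phi> (\<Gamma> m) k" "z \<in> \<Gamma> m" "x = y \<oplus>\<^bsub>A\<^esub> \<phi> k z"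
      using Suc.prems(3) by (auto elim!: set_add_memE)
    have zc: "z \<in> carrier A" and ac: "a \<in> carrier A" using x Suc.prems \<Gamma>_carrier by auto
    have k: "k < t" using Suc.prems by simp
    have "\<phi> k z \<in> carrier A" using module_hom_closed[OF hom[OF k]] zc by blast
    moreover have "y \<in> carrier A" using submoduleD(1)[OF S, of k m] x(1) k by auto
    ultimately have "act a x = act a y \<oplus>\<^bsub>A\<^esub> \<phi> k (act a z)"
      using x(3) act_add[OF ac] act_hom[OF k ac zc] by simp
    moreover have "act a y \<in> sum_images J \<phi> (\<Gamma> (i + m)) k" using Suc x by auto
    moreover have "act a z \<in> \<Gamma> (i + m)" using act_\<Gamma> Suc.prems x by blast
    ultimately show ?case by (simp add: set_add_memI)
  qed
  have "graded_stable act (L c)" for c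
  proof (rule graded_stableI)
    show "submodule K (L c n) A" for n
      unfolding L_def by (intro submodule_inter M submodule_\<Gamma> S order_refl)
    show "L c n \<subseteq> \<Gamma> n" for n by (auto simp: L_def)
    show "act a x \<in> L c (i + j)" if "a \<in> \<Gamma> i" "x \<in> L c j" for i j a x
      using that act_S[of t a i x "j + int c"] act_M[OF \<Gamma>_carrier] act_\<Gamma>[of a i x j]
      by (auto simp: L_def add.assoc)
  qed
  moreover have "L c n \<subseteq> L (Suc c) n" for c n
    using sum_images_mono[OF \<Gamma>_mono[of "n + int c" "n + int (Suc c)"]] by (auto simp: L_def)
  ultimately obtain c where c: "\<And>d n. L d n \<subseteq> L c n" using acc unfolding graded_acc_def by meson
  have "M \<inter> \<Gamma> n \<subseteq> sum_images J \<phi> (\<Gamma> (n + int c)) t" for n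
  proof
    fix x assume x: "x \<in> M \<inter> \<Gamma> n"
    then obtain m where m: "x \<in> sum_images J \<phi> (\<Gamma> m) t" 
      using sum_images_exhaust[OF J, of t \<phi> x] hom gen by blast
    have "x \<in> sum_images J \<phi> (\<Gamma> (n + int (nat (m - n)))) t"
      using m by (rule subsetD[OF sum_images_mono[OF \<Gamma>_mono], rotated]) simp
    then have "x \<in> L (nat (m - n)) n" using x by (simp add: L_def)
    then have "x \<in> L c n" using c by blast
    then show "x \<in> sum_images J \<phi> (\<Gamma> (n + int c)) t" by (simp add: L_def)
  qed
  then show ?thesis by blast
qed

text \<open>The upper bound is the previous lemma; the lower bound only expresses that the finitely many
  generators have finite degrees. All sufficiently large shifts are admitted, so that a common shift
  can be chosen for two systems of generators.\<close>

lemma sandwich: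
  assumes acc: "graded_acc act"
    and I: "submodule K I A" and J: "submodule K J A" and M: "submodule K M A" and "J \<subseteq> M"
    and hom: "\<And>k. k < t \<Longrightarrow> \<phi> k \<in> module_hom K A A"
    and gen: "M \<subseteq> sum_images J \<phi> (carrier A) t"
    and hom_I: "\<And>k. k < t \<Longrightarrow> \<phi> k ` I \<subseteq> J"
    and hom_M: "\<And>k. k < t \<Longrightarrow> \<phi> k ` carrier A \<subseteq> M"
    and hom_\<Gamma>: "\<And>k. k < t \<Longrightarrow> \<exists>e. \<forall>i. \<phi> k ` \<Gamma> i \<subseteq> \<Gamma> (i + e)"
    and act_add: "\<And>a x y. \<lbrakk>a \<in> carrier A; x \<in> carrier A; y \<in> carrier A\<rbrakk> \<Longrightarrow>
      act a (x \<oplus>\<^bsub>A\<^esub> y) = act a x \<oplus>\<^bsub>A\<^esub> act a y"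
    and act_\<Gamma>: "\<And>a x i j. \<lbrakk>a \<in> \<Gamma> i; x \<in> \<Gamma> j\<rbrakk> \<Longrightarrow> act a x \<in> \<Gamma> (i + j)"
    and act_J: "\<And>a x. \<lbrakk>a \<in> carrier A; x \<in> J\<rbrakk> \<Longrightarrow> act a x \<in> J"
    and act_M: "\<And>a x. \<lbrakk>a \<in> carrier A; x \<in> M\<rbrakk> \<Longrightarrow> act a x \<in> M"
    and act_hom: "\<And>a x k. \<lbrakk>k < t; a \<in> carrier A; x \<in> carrier A\<rbrakk> \<Longrightarrow> act a (\<phi> k x) = \<phi> k (act a x)"
  shows "\<exists>c::nat. \<forall>d\<ge>c. \<forall>n.
    J <+>\<^bsub>A\<^esub> (M \<inter> \<Gamma> n) \<subseteq> sum_images J \<phi> (coset_filtration I (n + int d)) t \<and>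
    sum_images J \<phi> (coset_filtration I (n - int d)) t \<subseteq> J <+>\<^bsub>A\<^esub> (M \<inter> \<Gamma> n)"
proof -
  have "\<exists>c::nat. \<forall>n. M \<inter> \<Gamma> n \<subseteq> sum_images J \<phi> (\<Gamma> (n + int c)) t"
    by (rule good_filtration[OF acc J M])
      ((rule hom gen act_add act_\<Gamma> act_J act_M act_hom; assumption) | rule gen)+
  then obtain c :: nat where c: "\<And>n. M \<inter> \<Gamma> n \<subseteq> sum_images J \<phi> (\<Gamma> (n + int c)) t" by blast
  obtain e where e: "\<And>k i. k < t \<Longrightarrow> \<phi> k ` \<Gamma> i \<subseteq> \<Gamma> (i + e k)" using hom_\<Gamma> by metis
  define d\<^sub>0 where "d\<^sub>0 = c + (\<Sum>k<t. nat (e k))"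
  have M\<Gamma>: "submodule K (M \<inter> \<Gamma> n) A" for n by (rule submodule_inter[OF M submodule_\<Gamma>])
  have JM: "submodule K (J <+>\<^bsub>A\<^esub> (M \<inter> \<Gamma> n)) A" for n by (rule submodule_set_add[OF J M\<Gamma>])
  note F = submodule_coset_filtration[OF I]
  note up = set_add_upper[OF J M\<Gamma>]
  have "J <+>\<^bsub>A\<^esub> (M \<inter> \<Gamma> n) \<subseteq> sum_images J \<phi> (coset_filtration I (n + int d)) t" if "d \<ge> d\<^sub>0" for d n
  proof (rule set_add_least)
    show "submodule K (sum_images J \<phi> (coset_filtration I (n + int d)) t) A"
      by (rule submodule_sum_images[OF J F hom])
    show "J \<subseteq> sum_images J \<phi> (coset_filtration I (n + int d)) t"
      by (rule sum_images_base[OF J F hom])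
    have "\<Gamma> (n + int c) \<subseteq> coset_filtration I (n + int d)"
      using set_add_upper(1)[OF submodule_\<Gamma> I, of "n + int d"] \<Gamma>_mono[of "n + int c" "n + int d"] that
      by (auto simp: coset_filtration_def d\<^sub>0_def)
    then show "M \<inter> \<Gamma> n \<subseteq> sum_images J \<phi> (coset_filtration I (n + int d)) t"
      using c sum_images_mono by blast
  qed
  moreover have "sum_images J \<phi> (coset_filtration I (n - int d)) t \<subseteq> J <+>\<^bsub>A\<^esub> (M \<inter> \<Gamma> n)"
    if "d \<ge> d\<^sub>0" for d n
  proof (rule sum_images_least[OF JM up(1)])
    fix k assume k: "k < t"
    interpret mod_hom K A A "\<phi> k" by unfold_locales (rule hom[OF k])
    have "nat (e k) \<le> (\<Sum>k<t. nat (e k))" using k by (intro member_le_sum) auto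
    then have ek: "n - int d + e k \<le> n" using that by (simp add: d\<^sub>0_def)
    show "\<phi> k ` coset_filtration I (n - int d) \<subseteq> J <+>\<^bsub>A\<^esub> (M \<inter> \<Gamma> n)"
    proof
      fix y assume "y \<in> \<phi> k ` coset_filtration I (n - int d)"
      then obtain u a where ua: "u \<in> \<Gamma> (n - int d)" "a \<in> I" "y = \<phi> k (u \<oplus>\<^bsub>A\<^esub> a)"
        by (auto simp: coset_filtration_def elim!: set_add_memE)
      have uc: "u \<in> carrier A" "a \<in> carrier A"
        using ua \<Gamma>_carrier submoduleD(1)[OF I] by auto
      have "\<phi> k u \<in> M \<inter> \<Gamma> n"
        using e[OF k, of "n - int d"] \<Gamma>_mono[OF ek] ua(1) hom_M[OF k] uc by blast
      then have "\<phi> k u \<in> J <+>\<^bsub>A\<^esub> (M \<inter> \<Gamma> n)" using up(2) by blast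
      moreover have "\<phi> k a \<in> J <+>\<^bsub>A\<^esub> (M \<inter> \<Gamma> n)" using hom_I[OF k] ua(2) up(1) by blast
      ultimately have "\<phi> k u \<oplus>\<^bsub>A\<^esub> \<phi> k a \<in> J <+>\<^bsub>A\<^esub> (M \<inter> \<Gamma> n)" by (rule submoduleD(3)[OF JM])
      then show "y \<in> J <+>\<^bsub>A\<^esub> (M \<inter> \<Gamma> n)" using ua(3) f_add[OF uc] by simp
    qed
  qed
  ultimately show ?thesis by blast
qed

end

section \<open>Bases of a free subquotient\<close>

context assoc_algebra
begin

text \<open>A basis of the subquotient, translated to elements of the algebra. The operation \<open>f\<close> is the
  action of the algebra on representatives, from the left or from the right. Independence is stated in
  the triangular form that \<open>rank_over_sum_images\<close> consumes: an element
  \<open>f x b\<^sub>k\<close> that is congruent to a combination of the earlier basis elements has two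
  representations in the basis, so their \<open>k\<close>-th coefficients \<open>x\<close> and \<open>0\<close> agree modulo \<open>I\<close>.\<close>

lemma free_subquotient_imp_basis:
  fixes Q :: "('a set, 'q) ring_scheme"
  assumes I: "ideal I A" and J: "ideal J A" and M: "ideal M A" and "J \<subseteq> M"
    and Q: "carrier Q = a_rcosets\<^bsub>A\<^esub> I"
    and free: "free_of_rank Q (subquotient A M J act) t"
    and bil: "\<And>y. y \<in> M \<Longrightarrow> (\<lambda>x. f x y) \<in> module_hom K A A"
    and fM: "\<And>x y. \<lbrakk>x \<in> carrier A; y \<in> M\<rbrakk> \<Longrightarrow> f x y \<in> M"
    and act: "\<And>x y. \<lbrakk>x \<in> carrier A; y \<in> M\<rbrakk> \<Longrightarrow>
      act (I +>\<^bsub>A\<^esub> x) (J +>\<^bsub>A\<^esub> y) = J +>\<^bsub>A\<^esub> f x y"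
  obtains b where "\<And>k. k < t \<Longrightarrow> b k \<in> M"
    and "M \<subseteq> sum_images J (\<lambda>k x. f x (b k)) (carrier A) t"
    and "\<And>k x. \<lbrakk>k < t; x \<in> carrier A; f x (b k) \<in> sum_images J (\<lambda>k x. f x (b k)) (carrier A) k\<rbrakk> \<Longrightarrow>
      x \<in> I"
proof -
  let ?S = "subquotient A M J act"
  have SJ: "submodule K J A" and SM: "submodule K M A" and SI: "submodule K I A"
    using I J M by (auto intro: submodule_ideal)
  interpret I: abelian_subgroup I A by (rule abelian_subgroup_submodule[OF SI])
  interpret J: abelian_subgroup J A by (rule abelian_subgroup_submodule[OF SJ])
  interpret S: left_module Q ?S using free by (simp add: free_of_rank_def)
  have Mc: "x \<in> carrier A" if "x \<in> M" for x using that submoduleD(1)[OF SM] by blast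
  have car: "carrier ?S = (\<lambda>x. J +>\<^bsub>A\<^esub> x) ` M" and zero: "\<zero>\<^bsub>?S\<^esub> = J" and add: "add ?S = set_add A"
    and smult: "smult ?S = act"
    by (simp_all add: subquotient_def)
  have "\<exists>b\<in>{..<t} \<rightarrow> carrier ?S. \<forall>x \<in> carrier ?S.
      \<exists>!c. c \<in> {..<t} \<rightarrow>\<^sub>E carrier Q \<and> x = (\<Oplus>\<^bsub>?S\<^esub>i\<in>{..<t}. c i \<odot>\<^bsub>?S\<^esub> b i)"
    using free unfolding free_of_rank_def by (rule conjunct2)
  then obtain b' where b': "b' \<in> {..<t} \<rightarrow> carrier ?S" and uniq: "\<forall>x \<in> carrier ?S.
      \<exists>!c. c \<in> {..<t} \<rightarrow>\<^sub>E carrier Q \<and> x = (\<Oplus>\<^bsub>?S\<^esub>i\<in>{..<t}. c i \<odot>\<^bsub>?S\<^esub> b' i)"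
    by (rule bexE)
  have "\<forall>k<t. \<exists>y\<in>M. b' k = J +>\<^bsub>A\<^esub> y" using b' by (auto simp: Pi_iff car)
  then obtain b where b: "\<And>k. k < t \<Longrightarrow> b k \<in> M" "\<And>k. k < t \<Longrightarrow> b' k = J +>\<^bsub>A\<^esub> b k" by metis
  define \<phi> where "\<phi> = (\<lambda>k x. f x (b k))"
  have hom: "\<phi> k \<in> module_hom K A A" if "k < t" for k unfolding \<phi>_def using bil b(1)[OF that] by blast
  have \<phi>M: "\<phi> k x \<in> M" if "k < t" "x \<in> carrier A" for k x unfolding \<phi>_def using fM b(1) that by blast
  have smult_rep: "(I +>\<^bsub>A\<^esub> x) \<odot>\<^bsub>?S\<^esub> b' k = J +>\<^bsub>A\<^esub> \<phi> k x" if "k < t" "x \<in> carrier A" for k x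
    using act[OF that(2) b(1)[OF that(1)]] b(2)[OF that(1)] by (simp add: smult \<phi>_def)
  have terms: "(I +>\<^bsub>A\<^esub> z) \<odot>\<^bsub>?S\<^esub> b' i \<in> carrier ?S" if "i < t" "z \<in> carrier A" for i z
    unfolding smult_rep[OF that] car by (rule imageI[OF \<phi>M[OF that]])
  let ?sum = "\<lambda>c k. \<Oplus>\<^bsub>?S\<^esub>i\<in>{..<k}. (I +>\<^bsub>A\<^esub> c i) \<odot>\<^bsub>?S\<^esub> b' i"
  have sum_Suc: "?sum c (Suc k) = ?sum c k <+>\<^bsub>A\<^esub> (J +>\<^bsub>A\<^esub> \<phi> k (c k))"
    and sum_car: "?sum c k \<in> carrier ?S"
    if "Suc k \<le> t" "c \<in> {..<Suc k} \<rightarrow> carrier A" for c k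
  proof -
    have *: "(\<lambda>i. (I +>\<^bsub>A\<^esub> c i) \<odot>\<^bsub>?S\<^esub> b' i) \<in> {..<Suc k} \<rightarrow> carrier ?S"
    proof (rule Pi_I)
      fix i assume "i \<in> {..<Suc k}"
      then show "(I +>\<^bsub>A\<^esub> c i) \<odot>\<^bsub>?S\<^esub> b' i \<in> carrier ?S" using that by (intro terms) auto
    qed
    show "?sum c k \<in> carrier ?S" by (rule S.finsum_closed) (use * in auto)
    have "?sum c (Suc k) = (I +>\<^bsub>A\<^esub> c k) \<odot>\<^bsub>?S\<^esub> b' k \<oplus>\<^bsub>?S\<^esub> ?sum c k"
      unfolding lessThan_Suc using * by (intro S.finsum_insert) auto
    also have "\<dots> = ?sum c k \<oplus>\<^bsub>?S\<^esub> (I +>\<^bsub>A\<^esub> c k) \<odot>\<^bsub>?S\<^esub> b' k"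
      using * \<open>?sum c k \<in> carrier ?S\<close> by (intro S.M.a_comm) auto
    finally show "?sum c (Suc k) = ?sum c k <+>\<^bsub>A\<^esub> (J +>\<^bsub>A\<^esub> \<phi> k (c k))"
      using that(1) smult_rep[of k "c k"] Pi_mem[OF that(2), of k] by (simp add: add)
  qed
  have into: "x \<in> sum_images J \<phi> (carrier A) k"
    if "k \<le> t" "c \<in> {..<k} \<rightarrow> carrier A" "x \<in> M" "J +>\<^bsub>A\<^esub> x = ?sum c k" for x k c
    using that
  proof (induction k arbitrary: x)
    case 0
    then have "J +>\<^bsub>A\<^esub> x = J" by (simp add: zero)
    then show ?case using J.a_rcos_self[OF Mc[OF 0(3)]] by simp
  next
    case (Suc k)
    obtain y where y: "y \<in> M" "?sum c k = J +>\<^bsub>A\<^esub> y"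
      using sum_car[OF Suc.prems(1,2)] by (auto simp: car)
    have p: "\<phi> k (c k) \<in> M"
      by (rule \<phi>M) (use Suc.prems(1) Pi_mem[OF Suc.prems(2), of k] in auto)
    have "J +>\<^bsub>A\<^esub> x = J +>\<^bsub>A\<^esub> (y \<oplus>\<^bsub>A\<^esub> \<phi> k (c k))"
      using Suc.prems(4) sum_Suc[OF Suc.prems(1,2)] y(2) J.a_rcos_sum[OF Mc[OF y(1)] Mc[OF p]] by simp
    then have "x \<in> J +>\<^bsub>A\<^esub> (y \<oplus>\<^bsub>A\<^esub> \<phi> k (c k))" using J.a_rcos_self[OF Mc[OF Suc.prems(3)]] by simp
    then obtain j where j: "j \<in> J" "x = j \<oplus>\<^bsub>A\<^esub> (y \<oplus>\<^bsub>A\<^esub> \<phi> k (c k))" by (auto simp: a_r_coset_def')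
    have jM: "j \<in> M" using j \<open>J \<subseteq> M\<close> by blast
    have "j \<oplus>\<^bsub>A\<^esub> y \<in> J +>\<^bsub>A\<^esub> y" using j by (auto simp: a_r_coset_def')
    then have "J +>\<^bsub>A\<^esub> (j \<oplus>\<^bsub>A\<^esub> y) = ?sum c k"
      using J.a_repr_independence'[of "j \<oplus>\<^bsub>A\<^esub> y" y] Mc[OF y(1)] y(2) by simp
    moreover have "j \<oplus>\<^bsub>A\<^esub> y \<in> M" using submoduleD(3)[OF SM jM y(1)] .
    ultimately have "j \<oplus>\<^bsub>A\<^esub> y \<in> sum_images J \<phi> (carrier A) k"
      using Suc.IH[of "j \<oplus>\<^bsub>A\<^esub> y"] Suc.prems(1,2) by (simp add: Pi_iff)
    moreover have "x = (j \<oplus>\<^bsub>A\<^esub> y) \<oplus>\<^bsub>A\<^esub> \<phi> k (c k)"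
      using j(2) Mc[OF jM] Mc[OF y(1)] Mc[OF p] by (simp add: module.M.a_assoc)
    ultimately show ?case
      using Suc.prems(2) by (simp add: Pi_iff set_add_memI)
  qed
  have from_sum: "\<exists>c\<in>{..<k} \<rightarrow> carrier A. x \<in> M \<and> J +>\<^bsub>A\<^esub> x = ?sum c k"
    if "k \<le> t" "x \<in> sum_images J \<phi> (carrier A) k" for x k
    using that
  proof (induction k arbitrary: x)
    case 0
    then show ?case using J.a_rcos_const[of x] \<open>J \<subseteq> M\<close> by (auto simp: zero)
  next
    case (Suc k)
    obtain y z where y: "y \<in> sum_images J \<phi> (carrier A) k" "z \<in> carrier A" "x = y \<oplus>\<^bsub>A\<^esub> \<phi> k z"
      using Suc.prems(2) by (auto elim!: set_add_memE)
    obtain c where c: "c \<in> {..<k} \<rightarrow> carrier A" "y \<in> M" "J +>\<^bsub>A\<^esub> y = ?sum c k"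
      using Suc.IH[OF _ y(1)] Suc.prems by auto
    have p: "\<phi> k z \<in> M" using \<phi>M[OF _ y(2)] Suc.prems by auto
    let ?c = "c(k := z)"
    have c': "?c \<in> {..<Suc k} \<rightarrow> carrier A" using c(1) y(2) by (auto simp: less_Suc_eq)
    have "?sum ?c k = ?sum c k"
    proof (rule S.finsum_cong')
      show "(\<lambda>i. (I +>\<^bsub>A\<^esub> c i) \<odot>\<^bsub>?S\<^esub> b' i) \<in> {..<k} \<rightarrow> carrier ?S"
        using c(1) Suc.prems by (intro Pi_I terms) auto
    qed auto
    then have "?sum ?c (Suc k) = J +>\<^bsub>A\<^esub> x"
      using sum_Suc[OF Suc.prems(1) c'] c(3) y(3) J.a_rcos_sum[OF Mc[OF c(2)] Mc[OF p]] by simp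
    moreover have "x \<in> M" using y(3) submoduleD(3)[OF SM c(2) p] by simp
    ultimately show ?case using c' by metis
  qed
  have gen: "M \<subseteq> sum_images J \<phi> (carrier A) t"
  proof
    fix x assume x: "x \<in> M"
    then obtain C where C: "C \<in> {..<t} \<rightarrow>\<^sub>E carrier Q" "J +>\<^bsub>A\<^esub> x = (\<Oplus>\<^bsub>?S\<^esub>i\<in>{..<t}. C i \<odot>\<^bsub>?S\<^esub> b' i)"
      using uniq by (auto simp: car)
    have "\<forall>k<t. \<exists>z\<in>carrier A. C k = I +>\<^bsub>A\<^esub> z" using C(1) by (auto simp: PiE_iff Q A_RCOSETS_def')
    then obtain c where c: "\<And>k. k < t \<Longrightarrow> c k \<in> carrier A" "\<And>k. k < t \<Longrightarrow> C k = I +>\<^bsub>A\<^esub> c k" by metis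
    have "(\<Oplus>\<^bsub>?S\<^esub>i\<in>{..<t}. C i \<odot>\<^bsub>?S\<^esub> b' i) = ?sum c t"
      by (rule S.finsum_cong') (use c in \<open>auto intro!: terms\<close>)
    then show "x \<in> sum_images J \<phi> (carrier A) t" using into[of t c x] c(1) x C(2) by auto
  qed
  have indep: "x \<in> I" if k: "k < t" and x: "x \<in> carrier A"
    and mem: "\<phi> k x \<in> sum_images J \<phi> (carrier A) k" for k x
  proof -
    obtain c where c: "c \<in> {..<k} \<rightarrow> carrier A" "J +>\<^bsub>A\<^esub> \<phi> k x = ?sum c k"
      using from_sum[OF _ mem] k by auto
    have zero_term: "(I +>\<^bsub>A\<^esub> \<zero>\<^bsub>A\<^esub>) \<odot>\<^bsub>?S\<^esub> b' i = \<zero>\<^bsub>?S\<^esub>" if "i < t" for i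
    proof -
      interpret mod_hom K A A "\<phi> i" by unfold_locales (rule hom[OF that])
      show ?thesis using smult_rep[OF that, of "\<zero>\<^bsub>A\<^esub>"] J.a_rcos_const[of "\<zero>\<^bsub>A\<^esub>"] by (simp add: zero)
    qed
    \<comment> \<open>The two representations of the class of \<open>\<phi> k x\<close>: by the earlier basis elements, and by \<open>b k\<close> alone.\<close>
  define c\<^sub>1 where "c\<^sub>1 i = (if i < k then c i else \<zero>\<^bsub>A\<^esub>)" for i
    define c\<^sub>2 where "c\<^sub>2 i = (if i = k then x else \<zero>\<^bsub>A\<^esub>)" for i
    have c12: "c\<^sub>1 i \<in> carrier A" "c\<^sub>2 i \<in> carrier A" for i
      using c(1) x by (auto simp: c\<^sub>1_def c\<^sub>2_def)
    have "?sum c k = ?sum c\<^sub>1 k"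
      by (rule S.finsum_cong') (use c12 k in \<open>auto simp: c\<^sub>1_def intro!: terms\<close>)
    also have "\<dots> = ?sum c\<^sub>1 t"
      by (rule S.add.finprod_mono_neutral_cong_left)
        (use c12 zero_term k c(1) in \<open>auto simp: c\<^sub>1_def intro!: terms\<close>)
    finally have 1: "J +>\<^bsub>A\<^esub> \<phi> k x = ?sum c\<^sub>1 t" using c(2) by simp
    have "(\<Oplus>\<^bsub>?S\<^esub>i\<in>{k}. (I +>\<^bsub>A\<^esub> c\<^sub>2 i) \<odot>\<^bsub>?S\<^esub> b' i) = ?sum c\<^sub>2 t"
      by (rule S.add.finprod_mono_neutral_cong_left)
        (use x zero_term k in \<open>auto simp: c\<^sub>2_def intro!: terms\<close>)
    moreover have "(\<Oplus>\<^bsub>?S\<^esub>i\<in>{k}. (I +>\<^bsub>A\<^esub> c\<^sub>2 i) \<odot>\<^bsub>?S\<^esub> b' i) = (I +>\<^bsub>A\<^esub> c\<^sub>2 k) \<odot>\<^bsub>?S\<^esub> b' k"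
      by (rule S.add.finprod_singleton_set) (rule terms[OF k c12(2)])
    ultimately have 2: "J +>\<^bsub>A\<^esub> \<phi> k x = ?sum c\<^sub>2 t" using smult_rep[OF k x] by (simp add: c\<^sub>2_def)
    define C where "C d = (\<lambda>i\<in>{..<t}. I +>\<^bsub>A\<^esub> d i)" for d :: "nat \<Rightarrow> 'a"
    have C: "C d \<in> {..<t} \<rightarrow>\<^sub>E carrier Q" if "\<And>i. d i \<in> carrier A" for d
      using that by (auto simp: C_def Q A_RCOSETS_def')
    have sum_C: "(\<Oplus>\<^bsub>?S\<^esub>i\<in>{..<t}. C d i \<odot>\<^bsub>?S\<^esub> b' i) = ?sum d t" if "\<And>i. d i \<in> carrier A" for d
      by (rule S.finsum_cong') (use that in \<open>auto simp: C_def intro!: terms\<close>)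
    have "\<exists>!c. c \<in> {..<t} \<rightarrow>\<^sub>E carrier Q \<and> J +>\<^bsub>A\<^esub> \<phi> k x = (\<Oplus>\<^bsub>?S\<^esub>i\<in>{..<t}. c i \<odot>\<^bsub>?S\<^esub> b' i)"
      using uniq \<phi>M[OF k x] by (auto simp: car)
    moreover have "J +>\<^bsub>A\<^esub> \<phi> k x = (\<Oplus>\<^bsub>?S\<^esub>i\<in>{..<t}. C c\<^sub>1 i \<odot>\<^bsub>?S\<^esub> b' i)"
      using 1 sum_C[of c\<^sub>1] c12(1) by simp
    moreover have "J +>\<^bsub>A\<^esub> \<phi> k x = (\<Oplus>\<^bsub>?S\<^esub>i\<in>{..<t}. C c\<^sub>2 i \<odot>\<^bsub>?S\<^esub> b' i)"
      using 2 sum_C[of c\<^sub>2] c12(2) by simp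
    ultimately have "C c\<^sub>1 = C c\<^sub>2" using C[of c\<^sub>1] C[of c\<^sub>2] c12 by blast
    then have "C c\<^sub>1 k = C c\<^sub>2 k" by simp
    then have "I +>\<^bsub>A\<^esub> \<zero>\<^bsub>A\<^esub> = I +>\<^bsub>A\<^esub> x" using k by (simp add: C_def c\<^sub>1_def c\<^sub>2_def)
    then show "x \<in> I" using I.a_rcos_self[OF x] I.a_rcos_const[of "\<zero>\<^bsub>A\<^esub>"] by simp
  qed
  show thesis using that[of b] b(1) gen indep unfolding \<phi>_def by blast
qed

end

text \<open>The product of representatives \<open>a + x\<close> and \<open>j + y\<close> differs from \<open>x y\<close> by \<open>a (j + y) + x j\<close>, which
  lies in \<open>J\<close>.\<close>

lemma (in ideal) quotient_action:
  assumes J: "ideal J R" and M: "ideal M R" and "J \<subseteq> M"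
    and x: "x \<in> carrier R" and y: "y \<in> M"
  shows "(\<And>a z. \<lbrakk>a \<in> I; z \<in> M\<rbrakk> \<Longrightarrow> a \<otimes> z \<in> J) \<Longrightarrow>
      [mod J:] (I +> x) \<Otimes> (J +> y) = J +> (x \<otimes> y)"
    and "(\<And>a z. \<lbrakk>a \<in> I; z \<in> M\<rbrakk> \<Longrightarrow> z \<otimes> a \<in> J) \<Longrightarrow>
      [mod J:] (J +> y) \<Otimes> (I +> x) = J +> (y \<otimes> x)"
proof -
  interpret J: ideal J R by (rule J)
  interpret M: ideal M R by (rule M)
  have rep: "J +> (u \<oplus> v) = J +> v" if "u \<in> J" "v \<in> carrier R" for u v
    using that J.a_repr_independence'[of "u \<oplus> v" v] by (auto simp: a_r_coset_def')
  have yc: "y \<in> carrier R" using y by simp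
  have self: "x \<in> I +> x" "y \<in> J +> y" using x yc a_rcos_self J.a_rcos_self by auto
  {
    assume IM: "\<And>a z. \<lbrakk>a \<in> I; z \<in> M\<rbrakk> \<Longrightarrow> a \<otimes> z \<in> J"
    have "J +> (x' \<otimes> y') = J +> (x \<otimes> y)" if xy: "x' \<in> I +> x" "y' \<in> J +> y" for x' y'
    proof -
      obtain a j where a: "a \<in> I" "x' = a \<oplus> x" and j: "j \<in> J" "y' = j \<oplus> y"
        using xy by (auto simp: a_r_coset_def')
      have y': "y' \<in> M" using j y \<open>J \<subseteq> M\<close> by auto
      have "x' \<otimes> y' = (a \<otimes> y' \<oplus> x \<otimes> j) \<oplus> x \<otimes> y"
        using a j x yc M.Icarr[OF y'] by (simp add: l_distr r_distr a_ac)
      moreover have "a \<otimes> y' \<oplus> x \<otimes> j \<in> J" using IM[OF a(1) y'] j x by (simp add: J.I_l_closed)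
      ultimately show ?thesis using rep x yc by simp
    qed
    then show "[mod J:] (I +> x) \<Otimes> (J +> y) = J +> (x \<otimes> y)"
      unfolding rcoset_mult_def using self by blast
  next
    assume MI: "\<And>a z. \<lbrakk>a \<in> I; z \<in> M\<rbrakk> \<Longrightarrow> z \<otimes> a \<in> J"
    have "J +> (y' \<otimes> x') = J +> (y \<otimes> x)" if xy: "x' \<in> I +> x" "y' \<in> J +> y" for x' y'
    proof -
      obtain a j where a: "a \<in> I" "x' = a \<oplus> x" and j: "j \<in> J" "y' = j \<oplus> y"
        using xy by (auto simp: a_r_coset_def')
      have y': "y' \<in> M" using j y \<open>J \<subseteq> M\<close> by auto
      have "y' \<otimes> x' = (y' \<otimes> a \<oplus> j \<otimes> x) \<oplus> y \<otimes> x"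
        using a j x yc M.Icarr[OF y'] by (simp add: l_distr r_distr a_ac)
      moreover have "y' \<otimes> a \<oplus> j \<otimes> x \<in> J" using MI[OF a(1) y'] j x by (simp add: J.I_r_closed)
      ultimately show ?thesis using rep x yc by simp
    qed
    then show "[mod J:] (J +> y) \<Otimes> (I +> x) = J +> (y \<otimes> x)"
      unfolding rcoset_mult_def using self by blast
  }
qed

section \<open>Comparison of the two ranks\<close>

context algebra_filtration
begin

text \<open>With \<open>\<Phi>(X)\<close> and \<open>\<Psi>(X)\<close> for the sums of images of \<open>X\<close> under the two families, there is a
  chain \<open>\<Phi>(F\<^bsub>m-2c\<^esub>) \<subseteq> N\<^bsub>m-c\<^esub> \<subseteq> \<Psi>(F\<^sub>m) \<subseteq> \<Psi>(F\<^sub>n) \<subseteq> N\<^bsub>n+c\<^esub> \<subseteq> \<Phi>(F\<^bsub>n+2c\<^esub>)\<close>. The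
  outer dimension is bounded from above by the number of generators, the inner one from below by
  independence.\<close>

lemma rank_inequality:
  assumes I: "submodule K I A" and J: "submodule K J A"
    and hom_\<phi>: "\<And>k. k < s \<Longrightarrow> \<phi> k \<in> module_hom K A A"
    and hom_\<psi>: "\<And>k. k < t \<Longrightarrow> \<psi> k \<in> module_hom K A A"
    and \<psi>_I: "\<And>k. k < t \<Longrightarrow> \<psi> k ` I \<subseteq> J"
    and indep: "\<And>k y. \<lbrakk>k < t; y \<in> carrier A; \<psi> k y \<in> sum_images J \<psi> (carrier A) k\<rbrakk> \<Longrightarrow> y \<in> I"
    and \<phi>: "\<And>n. N n \<subseteq> sum_images J \<phi> (coset_filtration I (n + int c)) s"
      "\<And>n. sum_images J \<phi> (coset_filtration I (n - int c)) s \<subseteq> N n"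
    and \<psi>: "\<And>n. N n \<subseteq> sum_images J \<psi> (coset_filtration I (n + int c)) t"
      "\<And>n. sum_images J \<psi> (coset_filtration I (n - int c)) t \<subseteq> N n"
    and "m \<le> n"
  shows "t * rank_over (coset_filtration I m) (coset_filtration I n)
    \<le> s * rank_over (coset_filtration I (m - int (2 * c))) (coset_filtration I (n + int (2 * c)))"
proof -
  note F = submodule_coset_filtration[OF I]
  let ?F = "coset_filtration I" and ?a = "m - int (2 * c)" and ?b = "n + int (2 * c)"
  have \<Phi>: "submodule K (sum_images J \<phi> (?F i) s) A" for i by (rule submodule_sum_images[OF J F hom_\<phi>])
  have \<Psi>: "submodule K (sum_images J \<psi> (?F i) t) A" for i by (rule submodule_sum_images[OF J F hom_\<psi>])
  have ab: "?a \<le> ?b" using \<open>m \<le> n\<close> by simp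
  have gen: "generated_over (s * rank_over (?F ?a) (?F ?b)) (sum_images J \<phi> (?F ?a) s) (sum_images J \<phi> (?F ?b) s)"
    by (intro generated_over_sum_images[OF J F F coset_filtration_mono[OF ab] hom_\<phi>]
        generated_over_rank[OF generated_over_coset_filtration[OF I ab]])
  have 1: "sum_images J \<phi> (?F ?a) s \<subseteq> sum_images J \<psi> (?F m) t"
    using \<phi>(2)[of "m - int c"] \<psi>(1)[of "m - int c"] by simp
  have 2: "sum_images J \<psi> (?F m) t \<subseteq> sum_images J \<psi> (?F n) t"
    by (rule sum_images_mono[OF coset_filtration_mono[OF \<open>m \<le> n\<close>]])
  have 3: "sum_images J \<psi> (?F n) t \<subseteq> sum_images J \<phi> (?F ?b) s"
    using \<psi>(2)[of "n + int c"] \<phi>(1)[of "n + int c"] by (simp add: add.assoc)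
  obtain q where q: "q \<le> s * rank_over (?F ?a) (?F ?b)"
    "generated_over q (sum_images J \<psi> (?F m) t) (sum_images J \<phi> (?F ?b) s)"
    using generated_over_split[OF \<Phi> \<Psi> \<Phi> 1 order_trans[OF 2 3] gen] by (meson add_leD2)
  obtain p where p: "p \<le> q" "generated_over p (sum_images J \<psi> (?F m) t) (sum_images J \<psi> (?F n) t)"
    using generated_over_split[OF \<Psi> \<Psi> \<Phi> 2 3 q(2)] by (meson add_leD1)
  have "t * rank_over (?F m) (?F n) \<le> p"
  proof (rule rank_over_sum_images[OF J I F F _ _ hom_\<psi> \<psi>_I indep p(2)])
    show "I \<subseteq> ?F m" unfolding coset_filtration_def by (rule set_add_upper(2)[OF submodule_\<Gamma> I])
    show "?F m \<subseteq> ?F n" by (rule coset_filtration_mono[OF \<open>m \<le> n\<close>])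
  qed
  then show ?thesis using p(1) q(1) by simp
qed

lemma left_right_zariskian_rank_le:
  assumes I: "ideal I A" and J: "ideal J A" and M: "ideal M A" and "J \<subset> M"
    and IM: "\<And>a x. \<lbrakk>a \<in> I; x \<in> M\<rbrakk> \<Longrightarrow> a \<otimes>\<^bsub>A\<^esub> x \<in> J"
    and MI: "\<And>a x. \<lbrakk>a \<in> I; x \<in> M\<rbrakk> \<Longrightarrow> x \<otimes>\<^bsub>A\<^esub> a \<in> J"
    and left: "free_of_rank (A Quot I) (left_subquotient A M J) s"
    and right: "free_of_rank (opp_ring (A Quot I)) (right_subquotient A M J) t"
    and "left_zariskian A \<Gamma>" and "right_zariskian A \<Gamma>"
  shows "t \<le> s"
proof (rule ccontr)
  assume "\<not> t \<le> s"
  then have "s < t" by simp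
  have "J \<subseteq> M" using \<open>J \<subset> M\<close> by blast
  interpret I: ideal I A by (rule I)
  interpret J: ideal J A by (rule J)
  interpret M: ideal M A by (rule M)
  have SI: "submodule K I A" and SJ: "submodule K J A" and SM: "submodule K M A"
    using I J M by (auto intro: submodule_ideal)
  have accl: "graded_acc (\<lambda>a x. a \<otimes>\<^bsub>A\<^esub> x)" and accr: "graded_acc (\<lambda>a x. x \<otimes>\<^bsub>A\<^esub> a)"
    using assms(9,10) left_noetherian_graded_acc right_noetherian_graded_acc
    by (auto simp: left_zariskian_def right_zariskian_def)
  have left_action: "[mod J:] (I +>\<^bsub>A\<^esub> x) \<Otimes>\<^bsub>A\<^esub> (J +>\<^bsub>A\<^esub> y) = J +>\<^bsub>A\<^esub> x \<otimes>\<^bsub>A\<^esub> y"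
    and right_action: "[mod J:] (J +>\<^bsub>A\<^esub> y) \<Otimes>\<^bsub>A\<^esub> (I +>\<^bsub>A\<^esub> x) = J +>\<^bsub>A\<^esub> y \<otimes>\<^bsub>A\<^esub> x"
    if "x \<in> carrier A" "y \<in> M" for x y
    using I.quotient_action[OF J M \<open>J \<subseteq> M\<close> that] IM MI by blast+
  obtain b where b: "\<And>k. k < s \<Longrightarrow> b k \<in> M"
    and bgen: "M \<subseteq> sum_images J (\<lambda>k x. x \<otimes>\<^bsub>A\<^esub> b k) (carrier A) s"
    by (rule free_subquotient_imp_basis[OF I J M \<open>J \<subseteq> M\<close> _ left[unfolded left_subquotient_def],
          where f = "\<lambda>x y. x \<otimes>\<^bsub>A\<^esub> y"])
      (simp_all add: FactRing_def M.I_l_closed right_mult_hom left_action, blast)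
  obtain b' where b': "\<And>k. k < t \<Longrightarrow> b' k \<in> M"
    and bgen': "M \<subseteq> sum_images J (\<lambda>k x. b' k \<otimes>\<^bsub>A\<^esub> x) (carrier A) t"
    and indep: "\<And>k x. \<lbrakk>k < t; x \<in> carrier A;
      b' k \<otimes>\<^bsub>A\<^esub> x \<in> sum_images J (\<lambda>k x. b' k \<otimes>\<^bsub>A\<^esub> x) (carrier A) k\<rbrakk> \<Longrightarrow> x \<in> I"
    by (rule free_subquotient_imp_basis[OF I J M \<open>J \<subseteq> M\<close> _ right[unfolded right_subquotient_def],
          where f = "\<lambda>x y. y \<otimes>\<^bsub>A\<^esub> x"])
      (simp_all add: FactRing_def opp_ring_def M.I_r_closed left_mult_hom right_action, blast)
  have degree: "\<exists>e. y \<in> \<Gamma> e" if "y \<in> M" for y using that exhaustive by auto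
  let ?\<phi> = "\<lambda>k x. x \<otimes>\<^bsub>A\<^esub> b k" and ?\<psi> = "\<lambda>k x. b' k \<otimes>\<^bsub>A\<^esub> x"
  let ?N = "\<lambda>n. J <+>\<^bsub>A\<^esub> (M \<inter> \<Gamma> n)" and ?F = "coset_filtration I"
  have hom: "\<And>k. k < s \<Longrightarrow> ?\<phi> k \<in> module_hom K A A" "\<And>k. k < t \<Longrightarrow> ?\<psi> k \<in> module_hom K A A"
    using b b' by (auto intro: right_mult_hom left_mult_hom)
  have "\<exists>c::nat. \<forall>d\<ge>c. \<forall>n. ?N n \<subseteq> sum_images J ?\<phi> (?F (n + int d)) s \<and>
      sum_images J ?\<phi> (?F (n - int d)) s \<subseteq> ?N n"
  proof (rule sandwich[OF accl SI SJ SM \<open>J \<subseteq> M\<close> hom(1) bgen])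
    show "\<exists>e. \<forall>i. ?\<phi> k ` \<Gamma> i \<subseteq> \<Gamma> (i + e)" if "k < s" for k
      using degree[OF b[OF that]] mult_mem by blast
  qed (use b IM mult_mem in \<open>auto simp: A.r_distr A.m_assoc J.I_l_closed M.I_l_closed\<close>)
  then obtain c where c: "\<And>d n. d \<ge> c \<Longrightarrow> ?N n \<subseteq> sum_images J ?\<phi> (?F (n + int d)) s"
    "\<And>d n. d \<ge> c \<Longrightarrow> sum_images J ?\<phi> (?F (n - int d)) s \<subseteq> ?N n" by blast
  have "\<exists>c::nat. \<forall>d\<ge>c. \<forall>n. ?N n \<subseteq> sum_images J ?\<psi> (?F (n + int d)) t \<and>
      sum_images J ?\<psi> (?F (n - int d)) t \<subseteq> ?N n"
  proof (rule sandwich[OF accr SI SJ SM \<open>J \<subseteq> M\<close> hom(2) bgen'])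
    show "\<exists>e. \<forall>i. ?\<psi> k ` \<Gamma> i \<subseteq> \<Gamma> (i + e)" if k: "k < t" for k
    proof -
      obtain e where e: "b' k \<in> \<Gamma> e" using degree[OF b'[OF k]] by blast
      show ?thesis using mult_mem[OF e] by (intro exI[of _ e]) (auto simp: add.commute)
    qed
    show "x \<otimes>\<^bsub>A\<^esub> a \<in> \<Gamma> (i + j)" if "a \<in> \<Gamma> i" "x \<in> \<Gamma> j" for a x i j
      using mult_mem[OF that(2,1)] by (simp add: add.commute)
  qed (use b' MI in \<open>auto simp: A.l_distr A.m_assoc J.I_r_closed M.I_r_closed\<close>)
  then obtain c' where c': "\<And>d n. d \<ge> c' \<Longrightarrow> ?N n \<subseteq> sum_images J ?\<psi> (?F (n + int d)) t"
    "\<And>d n. d \<ge> c' \<Longrightarrow> sum_images J ?\<psi> (?F (n - int d)) t \<subseteq> ?N n" by blast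
  show False
  proof (rule subexponential_rank_contradiction[where D = "\<lambda>m n. rank_over (?F m) (?F n)" and g = jump
        and s = s and t = t and c = "2 * max c c'" and m\<^sub>0 = "- 1" and n\<^sub>0 = 0])
    show "rank_over (?F m) (?F n) \<le> (\<Sum>i\<in>{m<..n}. jump i)" if "m \<le> n" for m n
      by (rule rank_over_le[OF generated_over_coset_filtration[OF SI that]])
    show "t * rank_over (?F m) (?F n)
        \<le> s * rank_over (?F (m - int (2 * max c c'))) (?F (n + int (2 * max c c')))" if "m \<le> n" for m n
    proof (rule rank_inequality[where N = ?N and \<phi> = ?\<phi> and \<psi> = ?\<psi>, OF SI SJ hom _ indep])
      show "?\<psi> k ` I \<subseteq> J" if "k < t" for k using MI b'[OF that] by auto
    qed (use c c' that in auto)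
    show "rank_over (?F (- 1)) (?F 0) > 0"
    proof (rule ccontr)
      assume "\<not> rank_over (?F (- 1)) (?F 0) > 0"
      then have "generated_over 0 (?F (- 1)) (?F 0)"
        using generated_over_rank[OF generated_over_coset_filtration[OF SI, of "- 1" 0]] by simp
      then have "?F (- 1) = ?F 0" by simp
      then have "\<one>\<^bsub>A\<^esub> \<in> \<Gamma> (- 1) <+>\<^bsub>A\<^esub> I"
        using one_mem set_add_upper(1)[OF submodule_\<Gamma> SI, of 0] by (auto simp: coset_filtration_def)
      then have "\<one>\<^bsub>A\<^esub> \<in> I"
        using one_in_ideal_by_jacobson[OF I] assms(9) by (simp add: left_zariskian_def)
      then have "M \<subseteq> J" using IM[of "\<one>\<^bsub>A\<^esub>"] by auto
      then show False using \<open>J \<subset> M\<close> by blast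
    qed
    show "\<exists>C. \<forall>i. real (jump i) \<le> C * r ^ nat \<bar>i\<bar>" if "r > 1" for r :: real
      by (rule subexponential_jumps[OF accl that])
  qed (use \<open>s < t\<close> in auto)
qed

end

theorem theorem2p4:
  fixes K :: "('k, 'm) ring_scheme"
    and R :: "('k, 'a, 'n) module_scheme"
    and I J\<^sub>1 J\<^sub>2 :: "'a set"
    and s t :: nat
  assumes "assoc_algebra K R"
    and "ideal I R" and "ideal J\<^sub>1 R" and "ideal J\<^sub>2 R"
    and "J\<^sub>1 \<subset> J\<^sub>2"
    and "\<And>a x. \<lbrakk>a \<in> I; x \<in> J\<^sub>2\<rbrakk> \<Longrightarrow> a \<otimes>\<^bsub>R\<^esub> x \<in> J\<^sub>1"
    and "\<And>a x. \<lbrakk>a \<in> I; x \<in> J\<^sub>2\<rbrakk> \<Longrightarrow> x \<otimes>\<^bsub>R\<^esub> a \<in> J\<^sub>1"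
    and "free_of_rank (R Quot I) (left_subquotient R J\<^sub>2 J\<^sub>1) s"
    and "free_of_rank (opp_ring (R Quot I)) (right_subquotient R J\<^sub>2 J\<^sub>1) t"
    and "s < t"
  shows "\<not> (\<exists>\<Gamma>. algebra_filtration K R \<Gamma> \<and> left_zariskian R \<Gamma> \<and> right_zariskian R \<Gamma>)"
proof
  assume "\<exists>\<Gamma>. algebra_filtration K R \<Gamma> \<and> left_zariskian R \<Gamma> \<and> right_zariskian R \<Gamma>"
  then obtain \<Gamma> where \<Gamma>: "algebra_filtration K R \<Gamma>" "left_zariskian R \<Gamma>" "right_zariskian R \<Gamma>"
    by blast
  then have "t \<le> s"
    by (intro algebra_filtration.left_right_zariskian_rank_le[OF \<Gamma>(1) assms(2-9)])
  then show False using \<open>s < t\<close> by simp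
qed

end
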